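(* Let $\Psi\colon\mathbb{L}^2\to\mathbb{L}^2$, $\Psi\mathcal{G}=Y(T,\cdot,\mathcal{G})$, where $Y(t,\cdot,\mathcal{G})=(y,y_\Gamma)$ is the mild solution, with initial datum $\mathcal{G}\in\mathbb{L}^2$, of $$\begin{cases}\partial_t y-d\Delta y=0 & \text{in }(0,T)\times\Omega,\\ \partial_t y_\Gamma-\gamma\Delta_\Gamma y_\Gamma+d\,\partial_\nu y=0 & \text{on }(0,T)\times\Gamma,\\ y_\Gamma=y_{|\Gamma} & \text{on }(0,T)\times\Gamma,\\ (y,y_\Gamma)|_{t=0}=\mathcal{G}.\end{cases}$$ Let $Y_T\in\mathbb{L}^2$ be noise-free measured data and set $Y_{T,k}=\langle Y_T,\phi_k\rangle$ for $k\ge1$. Then the backward problem $\Psi\mathcal{G}=Y_T$ admits a solution $\mathcal{G}\in\mathbb{L}^2$ if and only if $$\sum_{k=1}^\infty e^{\lambda_kT}\,Y_{T,k}^2<\infty ,$$ and in that case the solution is given by $$\mathcal{G}=\sum_{k=1}^\infty e^{\lambda_kT}\,Y_{T,k}\,\phi_k .$$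
   Context: Setting: $T>0$; $\Omega\subset\mathbb{R}^N$ ($N\ge1$) is a bounded domain with boundary $\Gamma=\partial\Omega$ of class $C^2$; $d>0$, and $\gamma>0$ if $N\ge2$, with the convention $\gamma=0$ if $N=1$. $\Delta$ is the Laplacian, $\Delta_\Gamma$ the Laplace–Beltrami operator on $\Gamma$, $\nu$ the unit outward normal, $\partial_\nu y=(\nabla y\cdot\nu)_{|\Gamma}$, $y_{|\Gamma}$ the trace. $\mathbb{L}^2=L^2(\Omega,dx)\times L^2(\Gamma,dS)$ is the Hilbert space with inner product $\langle(y,y_\Gamma),(z,z_\Gamma)\rangle=\langle y,z\rangle_{L^2(\Omega)}+\langle y_\Gamma,z_\Gamma\rangle_{L^2(\Gamma)}$, and $\mathbb{H}^2=\{(y,y_\Gamma)\in H^2(\Omega)\times H^2(\Gamma): y_{|\Gamma}=y_\Gamma\}$. $\mathcal{A}_0(y,y_\Gamma)=(d\Delta y,\,-d\,\partial_\nu y+\gamma\Delta_\Gamma y_\Gamma)$ with domain $D(\mathcal{A}_0)=\mathbb{H}^2$ generates an analytic $C_0$-semigroup $(e^{t\mathcal{A}_0})_{t\ge0}$ on $\mathbb{L}^2$, and the mild solution above is $Y(t,\cdot,\mathcal{G})=e^{t\mathcal{A}_0}\mathcal{G}$. $(\lambda_k)_{k\ge1}$ denotes the increasing sequence of eigenvalues that constitutes the spectrum of $-\mathcal{A}_0$, with $0=\lambda_1<\lambda_2<\cdots$ and $\lambda_k\to\infty$, and $(\phi_k)_{k\ge1}$ the sequence of the corresponding eigenfunctions,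 $-\mathcal{A}_0\phi_k=\lambda_k\phi_k$, which forms an orthonormal basis of $\mathbb{L}^2$.
   Formalization: The solvability condition is stated with e^{2λ_kT} instead of the printed e^{λ_kT}, for which the equivalence is false (Y_T = Σ_j e^{-λ_{k_j}T}φ_{k_j}, λ_{k_j} ≥ j); eigenvalues are listed with multiplicity (nondecreasing). *)

theory Defs
  imports "HOL-Analysis.Analysis" "HOL-Library.Function_Algebras"
begin

section \<open>Functions of class \<open>C\<^sup>k\<close>, domains of class \<open>C\<^sup>2\<close>\<close>

definition partial_deriv :: "'a::euclidean_space \<Rightarrow> ('a \<Rightarrow> real) \<Rightarrow> 'a \<Rightarrow> real" where
  "partial_deriv i f x = frechet_derivative f (at x) i"

definition grad :: "('a::euclidean_space \<Rightarrow> real) \<Rightarrow> 'a \<Rightarrow> 'a" where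
  "grad f x = (\<Sum>i\<in>Basis. partial_deriv i f x *\<^sub>R i)"

text \<open>Only used for open sets \<open>U\<close>.\<close>

primrec Ck_on :: "nat \<Rightarrow> ('a::euclidean_space \<Rightarrow> real) \<Rightarrow> 'a set \<Rightarrow> bool" where
  "Ck_on 0 f U \<longleftrightarrow> continuous_on U f"
| "Ck_on (Suc k) f U \<longleftrightarrow> f differentiable_on U \<and> (\<forall>i\<in>Basis. Ck_on k (partial_deriv i f) U)"

definition test_function :: "'a::euclidean_space set \<Rightarrow> ('a \<Rightarrow> real) \<Rightarrow> bool" where
  "test_function \<Omega> \<theta> \<longleftrightarrow>
     (\<forall>k. Ck_on k \<theta> UNIV) \<and> compact (closure {x. \<theta> x \<noteq> 0}) \<and> closure {x. \<theta> x \<noteq> 0} \<subseteq> \<Omega>"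

definition defining_function :: "'a::euclidean_space set \<Rightarrow> 'a set \<Rightarrow> ('a \<Rightarrow> real) \<Rightarrow> bool" where
  "defining_function \<Omega> U \<rho> \<longleftrightarrow>
     open U \<and> Ck_on 2 \<rho> U \<and> (\<forall>x\<in>U. grad \<rho> x \<noteq> 0) \<and> \<Omega> \<inter> U = {x \<in> U. \<rho> x < 0}"

definition C2_boundary :: "'a::euclidean_space set \<Rightarrow> bool" where
  "C2_boundary \<Omega> \<longleftrightarrow> (\<forall>p\<in>frontier \<Omega>. \<exists>U \<rho>. p \<in> U \<and> defining_function \<Omega> U \<rho>)"

definition C2_domain :: "'a::euclidean_space set \<Rightarrow> bool" where
  "C2_domain \<Omega> \<longleftrightarrow> open \<Omega> \<and> connected \<Omega> \<and> \<Omega> \<noteq> {} \<and> bounded \<Omega> \<and> C2_boundary \<Omega>"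

text \<open>For a \<open>C\<^sup>2\<close> boundary the normalised gradient at \<open>p\<close> does not depend on the
  defining function, so the choice below is no choice.\<close>

definition outward_normal :: "'a::euclidean_space set \<Rightarrow> 'a \<Rightarrow> 'a" where
  "outward_normal \<Omega> p =
     (SOME n. \<exists>U \<rho>. p \<in> U \<and> defining_function \<Omega> U \<rho> \<and> n = sgn (grad \<rho> p))"


section \<open>Surface measure\<close>

text \<open>The \<open>s\<close>-dimensional Hausdorff outer measure with the normalisation that makes it agree with
  the surface area on hypersurfaces (\<open>s = N - 1\<close>). Empty covering sets are skipped because
  \<open>0 ^ 0 = 1\<close> would make them count when \<open>s = 0\<close>; for \<open>s = 0\<close> it is the counting measure.\<close>

definition hausdorff_pre :: "nat \<Rightarrow> real \<Rightarrow> 'a::metric_space set \<Rightarrow> ennreal" where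
  "hausdorff_pre s \<delta> A =
     (INF C \<in> {C :: nat \<Rightarrow> 'a set. A \<subseteq> (\<Union>i. C i) \<and> (\<forall>i. bounded (C i) \<and> diameter (C i) \<le> \<delta>)}.
        \<Sum>i. if C i = {} then 0
             else ennreal (unit_ball_vol (real s) * (diameter (C i) / 2) ^ s))"

definition hausdorff_outer :: "nat \<Rightarrow> 'a::metric_space set \<Rightarrow> ennreal" where
  "hausdorff_outer s A = (SUP \<delta>\<in>{0<..}. hausdorff_pre s \<delta> A)"

definition surface_measure :: "'a::euclidean_space set \<Rightarrow> 'a measure" where
  "surface_measure \<Omega> =
     measure_of (frontier \<Omega>) (sets (restrict_space borel (frontier \<Omega>)))
       (hausdorff_outer (DIM('a) - 1))"


section \<open>The space \<open>L\<^sup>2(\<Omega>) \<times> L\<^sup>2(\<Gamma>)\<close>\<close>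

text \<open>Elements of an \<open>L\<^sup>2\<close> space are represented by functions. All notions
  below depend on the functions only up to equality almost everywhere.\<close>

definition square_integrable :: "'a measure \<Rightarrow> ('a \<Rightarrow> real) set" where
  "square_integrable M = {f \<in> borel_measurable M. integrable M (\<lambda>x. (f x)\<^sup>2)}"

definition l2_tendsto :: "'a measure \<Rightarrow> (nat \<Rightarrow> 'a \<Rightarrow> real) \<Rightarrow> ('a \<Rightarrow> real) \<Rightarrow> bool" where
  "l2_tendsto M u f \<longleftrightarrow>
     (\<forall>n. u n \<in> square_integrable M) \<and> f \<in> square_integrable M \<and>
     (\<lambda>n. LINT x|M. (u n x - f x)\<^sup>2) \<longlonglongrightarrow> 0"

type_synonym 'a state = "('a \<Rightarrow> real) \<times> ('a \<Rightarrow> real)"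

definition LL2 :: "'a::euclidean_space set \<Rightarrow> 'a state set" where
  "LL2 \<Omega> = square_integrable (lebesgue_on \<Omega>) \<times> square_integrable (surface_measure \<Omega>)"

definition LL2_inner :: "'a::euclidean_space set \<Rightarrow> 'a state \<Rightarrow> 'a state \<Rightarrow> real" where
  "LL2_inner \<Omega> Y Z =
     (LINT x|lebesgue_on \<Omega>. fst Y x * fst Z x) + (LINT x|surface_measure \<Omega>. snd Y x * snd Z x)"

definition LL2_norm :: "'a::euclidean_space set \<Rightarrow> 'a state \<Rightarrow> real" where
  "LL2_norm \<Omega> Y = sqrt (LL2_inner \<Omega> Y Y)"

definition LL2_eq :: "'a::euclidean_space set \<Rightarrow> 'a state \<Rightarrow> 'a state \<Rightarrow> bool" where
  "LL2_eq \<Omega> Y Z \<longleftrightarrow>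
     (AE x in lebesgue_on \<Omega>. fst Y x = fst Z x) \<and>
     (AE x in surface_measure \<Omega>. snd Y x = snd Z x)"

definition smul :: "real \<Rightarrow> 'a state \<Rightarrow> 'a state" where
  "smul c Y = ((\<lambda>x. c * fst Y x), (\<lambda>x. c * snd Y x))"

text \<open>The series \<open>\<Sum>k\<ge>1. V k\<close> converges to \<open>X\<close> in the norm of \<open>LL2 \<Omega>\<close>.\<close>

definition LL2_sums :: "'a::euclidean_space set \<Rightarrow> (nat \<Rightarrow> 'a state) \<Rightarrow> 'a state \<Rightarrow> bool" where
  "LL2_sums \<Omega> V X \<longleftrightarrow> (\<lambda>n. LL2_norm \<Omega> ((\<Sum>k=1..n. V k) - X)) \<longlonglongrightarrow> 0"

definition orthonormal_basis :: "'a::euclidean_space set \<Rightarrow> (nat \<Rightarrow> 'a state) \<Rightarrow> bool" where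
  "orthonormal_basis \<Omega> \<phi> \<longleftrightarrow>
     (\<forall>k\<ge>1. \<phi> k \<in> LL2 \<Omega>) \<and>
     (\<forall>j\<ge>1. \<forall>k\<ge>1. LL2_inner \<Omega> (\<phi> j) (\<phi> k) = (if j = k then 1 else 0)) \<and>
     (\<forall>X\<in>LL2 \<Omega>. \<forall>\<epsilon>>0. \<exists>n c. LL2_norm \<Omega> (X - (\<Sum>k=1..n. smul (c k) (\<phi> k))) < \<epsilon>)"


section \<open>Sobolev spaces, traces and the differential operators\<close>

text \<open>\<open>weak_gradient \<Omega> f p\<close>: \<open>f \<in> H\<^sup>1(\<Omega>)\<close> with \<open>\<nabla>f = p\<close>.\<close>

definition weak_gradient :: "'a::euclidean_space set \<Rightarrow> ('a \<Rightarrow> real) \<Rightarrow> ('a \<Rightarrow> 'a) \<Rightarrow> bool" where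
  "weak_gradient \<Omega> f p \<longleftrightarrow>
     f \<in> square_integrable (lebesgue_on \<Omega>) \<and>
     (\<forall>i\<in>Basis. (\<lambda>x. p x \<bullet> i) \<in> square_integrable (lebesgue_on \<Omega>) \<and>
        (\<forall>\<theta>. test_function \<Omega> \<theta> \<longrightarrow>
           (LINT x|lebesgue_on \<Omega>. f x * partial_deriv i \<theta> x) =
             - (LINT x|lebesgue_on \<Omega>. (p x \<bullet> i) * \<theta> x)))"

definition H2_bulk :: "'a::euclidean_space set \<Rightarrow> ('a \<Rightarrow> real) set" where
  "H2_bulk \<Omega> =
     {f. \<exists>p. weak_gradient \<Omega> f p \<and> (\<forall>i\<in>Basis. \<exists>q. weak_gradient \<Omega> (\<lambda>x. p x \<bullet> i) q)}"

text \<open>\<open>has_laplacian \<Omega> f h\<close>: \<open>f \<in> H\<^sup>2(\<Omega>)\<close> and \<open>\<Delta>f = h\<close>.\<close>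

definition has_laplacian :: "'a::euclidean_space set \<Rightarrow> ('a \<Rightarrow> real) \<Rightarrow> ('a \<Rightarrow> real) \<Rightarrow> bool" where
  "has_laplacian \<Omega> f h \<longleftrightarrow>
     (\<exists>p q. weak_gradient \<Omega> f p \<and> (\<forall>i\<in>Basis. weak_gradient \<Omega> (\<lambda>x. p x \<bullet> i) (q i)) \<and>
        (AE x in lebesgue_on \<Omega>. h x = (\<Sum>i\<in>Basis. q i x \<bullet> i)))"

text \<open>The trace \<open>H\<^sup>1(\<Omega>) \<rightarrow> L\<^sup>2(\<Gamma>)\<close> is the continuous extension of the restriction of
  functions that are \<open>C\<^sup>1\<close> up to the boundary.\<close>

definition has_trace :: "'a::euclidean_space set \<Rightarrow> ('a \<Rightarrow> real) \<Rightarrow> ('a \<Rightarrow> real) \<Rightarrow> bool" where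
  "has_trace \<Omega> f g \<longleftrightarrow>
     (\<exists>p u. weak_gradient \<Omega> f p \<and> (\<forall>n. Ck_on 1 (u n) UNIV) \<and>
        l2_tendsto (lebesgue_on \<Omega>) u f \<and>
        (\<forall>i\<in>Basis. l2_tendsto (lebesgue_on \<Omega>) (\<lambda>n x. grad (u n) x \<bullet> i) (\<lambda>x. p x \<bullet> i)) \<and>
        l2_tendsto (surface_measure \<Omega>) u g)"

definition has_normal_derivative ::
    "'a::euclidean_space set \<Rightarrow> ('a \<Rightarrow> real) \<Rightarrow> ('a \<Rightarrow> real) \<Rightarrow> bool" where
  "has_normal_derivative \<Omega> f b \<longleftrightarrow>
     (\<exists>p t. weak_gradient \<Omega> f p \<and> (\<forall>i\<in>Basis. has_trace \<Omega> (\<lambda>x. p x \<bullet> i) (\<lambda>x. t x \<bullet> i)) \<and>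
        (AE x in surface_measure \<Omega>. b x = t x \<bullet> outward_normal \<Omega> x))"

definition tangential_grad ::
    "'a::euclidean_space set \<Rightarrow> ('a \<Rightarrow> real) \<Rightarrow> 'a \<Rightarrow> 'a" where
  "tangential_grad \<Omega> u x =
     grad u x - (grad u x \<bullet> outward_normal \<Omega> x) *\<^sub>R outward_normal \<Omega> x"

text \<open>\<open>surface_gradient \<Omega> g w\<close>: \<open>g \<in> H\<^sup>1(\<Gamma>)\<close> with \<open>\<nabla>\<^sub>\<Gamma> g = w\<close>, where \<open>\<nabla>\<^sub>\<Gamma>\<close> is the closure in
  \<open>L\<^sup>2(\<Gamma>)\<close> of the tangential gradient of \<open>C\<^sup>1\<close> functions.\<close>

definition surface_gradient :: "'a::euclidean_space set \<Rightarrow> ('a \<Rightarrow> real) \<Rightarrow> ('a \<Rightarrow> 'a) \<Rightarrow> bool" where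
  "surface_gradient \<Omega> g w \<longleftrightarrow>
     (\<exists>u. (\<forall>n. Ck_on 1 (u n) UNIV) \<and>
        l2_tendsto (surface_measure \<Omega>) u g \<and>
        (\<forall>i\<in>Basis. l2_tendsto (surface_measure \<Omega>)
            (\<lambda>n x. tangential_grad \<Omega> (u n) x \<bullet> i) (\<lambda>x. w x \<bullet> i)))"

text \<open>On a \<open>C\<^sup>2\<close> hypersurface the ambient components of \<open>\<nabla>\<^sub>\<Gamma> g\<close> lie in \<open>H\<^sup>1(\<Gamma>)\<close> iff
  \<open>g\<close> has two weak derivatives in local charts.\<close>

definition H2_surface :: "'a::euclidean_space set \<Rightarrow> ('a \<Rightarrow> real) set" where
  "H2_surface \<Omega> =
     {g. \<exists>w. surface_gradient \<Omega> g w \<and> (\<forall>i\<in>Basis. \<exists>v. surface_gradient \<Omega> (\<lambda>x. w x \<bullet> i) v)}"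

text \<open>\<open>\<Delta>\<^sub>\<Gamma> = div\<^sub>\<Gamma> \<nabla>\<^sub>\<Gamma>\<close>, where the surface divergence of a tangential field \<open>w\<close> is the sum over \<open>i\<close>
  of the \<open>i\<close>-th component of \<open>\<nabla>\<^sub>\<Gamma> w\<^sub>i\<close>.\<close>

definition has_laplace_beltrami ::
    "'a::euclidean_space set \<Rightarrow> ('a \<Rightarrow> real) \<Rightarrow> ('a \<Rightarrow> real) \<Rightarrow> bool" where
  "has_laplace_beltrami \<Omega> g h \<longleftrightarrow>
     (\<exists>w v. surface_gradient \<Omega> g w \<and> (\<forall>i\<in>Basis. surface_gradient \<Omega> (\<lambda>x. w x \<bullet> i) (v i)) \<and>
        (AE x in surface_measure \<Omega>. h x = (\<Sum>i\<in>Basis. v i x \<bullet> i)))"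

definition HH2 :: "'a::euclidean_space set \<Rightarrow> 'a state set" where
  "HH2 \<Omega> = {Y. fst Y \<in> H2_bulk \<Omega> \<and> snd Y \<in> H2_surface \<Omega> \<and> has_trace \<Omega> (fst Y) (snd Y)}"


section \<open>Unbounded operators on \<open>LL2 \<Omega>\<close>\<close>

text \<open>An operator is given by its graph: \<open>A Y Z\<close> means \<open>Y \<in> D(A)\<close> and \<open>A Y = Z\<close>, both
  up to equality almost everywhere.\<close>

type_synonym 'a operator = "'a state \<Rightarrow> 'a state \<Rightarrow> bool"

definition A0 :: "'a::euclidean_space set \<Rightarrow> real \<Rightarrow> real \<Rightarrow> 'a operator" where
  "A0 \<Omega> d \<gamma> Y Z \<longleftrightarrow>
     Y \<in> HH2 \<Omega> \<and> Z \<in> LL2 \<Omega> \<and>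
     (\<exists>l b s. has_laplacian \<Omega> (fst Y) l \<and> has_normal_derivative \<Omega> (fst Y) b \<and>
        has_laplace_beltrami \<Omega> (snd Y) s \<and>
        LL2_eq \<Omega> Z ((\<lambda>x. d * l x), (\<lambda>x. - d * b x + \<gamma> * s x)))"

definition neg_op :: "'a operator \<Rightarrow> 'a operator" where
  "neg_op A Y Z \<longleftrightarrow> A Y (smul (-1) Z)"

text \<open>Only real \<open>\<mu>\<close> are considered: the operator of interest is self-adjoint, so its spectrum is real.\<close>

definition resolvent_set :: "'a::euclidean_space set \<Rightarrow> 'a operator \<Rightarrow> real set" where
  "resolvent_set \<Omega> A =
     {\<mu>. (\<forall>X Z. A X Z \<and> LL2_eq \<Omega> (smul \<mu> X - Z) 0 \<longrightarrow> LL2_eq \<Omega> X 0) \<and>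
         (\<exists>M. \<forall>F\<in>LL2 \<Omega>. \<exists>X Z. A X Z \<and> LL2_eq \<Omega> (smul \<mu> X - Z) F \<and>
            LL2_norm \<Omega> X \<le> M * LL2_norm \<Omega> F)}"

definition op_spectrum :: "'a::euclidean_space set \<Rightarrow> 'a operator \<Rightarrow> real set" where
  "op_spectrum \<Omega> A = - resolvent_set \<Omega> A"

text \<open>\<open>lam\<close> and \<open>\<phi>\<close> are indexed by \<open>k \<ge> 1\<close>; the values at \<open>0\<close> are irrelevant. Eigenvalues are
  repeated according to multiplicity (the first one, \<open>0\<close>, is simple).\<close>

definition eigensystem ::
    "'a::euclidean_space set \<Rightarrow> 'a operator \<Rightarrow> (nat \<Rightarrow> real) \<Rightarrow> (nat \<Rightarrow> 'a state) \<Rightarrow> bool" where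
  "eigensystem \<Omega> B lam \<phi> \<longleftrightarrow>
     mono_on {1..} lam \<and> lam 1 = 0 \<and> 0 < lam 2 \<and> filterlim lam at_top sequentially \<and>
     op_spectrum \<Omega> B = lam ` {1..} \<and>
     (\<forall>k\<ge>1. B (\<phi> k) (smul (lam k) (\<phi> k))) \<and>
     orthonormal_basis \<Omega> \<phi>"


section \<open>Semigroups and mild solutions\<close>

definition C0_semigroup ::
    "'a::euclidean_space set \<Rightarrow> (real \<Rightarrow> 'a state \<Rightarrow> 'a state) \<Rightarrow> bool" where
  "C0_semigroup \<Omega> S \<longleftrightarrow>
     (\<forall>t\<ge>0. \<forall>X\<in>LL2 \<Omega>. S t X \<in> LL2 \<Omega>) \<and>
     (\<forall>t\<ge>0. \<forall>X\<in>LL2 \<Omega>. \<forall>Y\<in>LL2 \<Omega>. \<forall>a b.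
        LL2_eq \<Omega> (S t (smul a X + smul b Y)) (smul a (S t X) + smul b (S t Y))) \<and>
     (\<forall>t\<ge>0. \<exists>M. \<forall>X\<in>LL2 \<Omega>. LL2_norm \<Omega> (S t X) \<le> M * LL2_norm \<Omega> X) \<and>
     (\<forall>X\<in>LL2 \<Omega>. LL2_eq \<Omega> (S 0 X) X) \<and>
     (\<forall>s\<ge>0. \<forall>t\<ge>0. \<forall>X\<in>LL2 \<Omega>. LL2_eq \<Omega> (S (s + t) X) (S s (S t X))) \<and>
     (\<forall>X\<in>LL2 \<Omega>. ((\<lambda>t. LL2_norm \<Omega> (S t X - X)) \<longlongrightarrow> 0) (at_right 0))"

definition generator ::
    "'a::euclidean_space set \<Rightarrow> (real \<Rightarrow> 'a state \<Rightarrow> 'a state) \<Rightarrow> 'a operator" where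
  "generator \<Omega> S X Z \<longleftrightarrow>
     X \<in> LL2 \<Omega> \<and> Z \<in> LL2 \<Omega> \<and>
     ((\<lambda>h. LL2_norm \<Omega> (smul (1 / h) (S h X - X) - Z)) \<longlongrightarrow> 0) (at_right 0)"

text \<open>\<open>S t = exp (t A)\<close>; the semigroup is determined by \<open>A\<close> up to equality almost everywhere.\<close>

definition generates ::
    "'a::euclidean_space set \<Rightarrow> 'a operator \<Rightarrow> (real \<Rightarrow> 'a state \<Rightarrow> 'a state) \<Rightarrow> bool" where
  "generates \<Omega> A S \<longleftrightarrow> C0_semigroup \<Omega> S \<and> generator \<Omega> S = A"

text \<open>The mild solution at time \<open>t\<close> of the homogeneous problem with initial datum \<open>G\<close>, and the
  operator that maps \<open>G\<close> to its value at the final time \<open>T\<close>.\<close>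

definition mild_solution :: "(real \<Rightarrow> 'a state \<Rightarrow> 'a state) \<Rightarrow> real \<Rightarrow> 'a state \<Rightarrow> 'a state" where
  "mild_solution S t G = S t G"

definition final_state :: "(real \<Rightarrow> 'a state \<Rightarrow> 'a state) \<Rightarrow> real \<Rightarrow> 'a state \<Rightarrow> 'a state" where
  "final_state S T G = mild_solution S T G"

end

theory Submission
  imports Defs
begin

text \<open>
  In the eigenbasis the solution operator is diagonal: \<open>S T\<close> multiplies the \<open>k\<close>-th coefficient by
  \<open>exp (- lam k * T)\<close>. Hence \<open>S T G = Y_T\<close> holds exactly when the coefficients of \<open>G\<close> are
  \<open>exp (lam k * T) * \<langle>Y_T, \<phi> k\<rangle>\<close>, and by Bessel's inequality and the Riesz-Fischer theorem such a \<open>G\<close>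
  exists exactly when these numbers are square summable; it is then the sum of its Fourier series.
  That argument is \<open>backward_problem\<close>.

  It rests on two facts. The first is that \<open>L\<^sup>2(\<Omega>) \<times> L\<^sup>2(\<Gamma>)\<close> is complete (\<open>l2_complete\<close>,
  \<open>semi_hilbert_LL2\<close>). The second is that an eigenvector of the generator evolves by
  \<open>S t \<phi> = exp (\<mu> * t) \<phi>\<close> (\<open>eigenvector_orbit\<close>), from which \<open>S_coeff\<close> gets all coefficients by
  linearity and continuity. The generator only controls the right derivative at time \<open>0\<close>; to
  integrate it, an interval is divided into \<open>n\<close> equal steps with errors of order \<open>o(1/n)\<close>, which
  requires a bound on \<open>S t\<close> that is uniform for small \<open>t\<close> (\<open>locally_bounded\<close>). That bound is a
  consequence of the uniform boundedness principle (\<open>uniform_boundedness\<close>) and so again of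
  completeness.
\<close>

section \<open>Complete spaces with a semidefinite inner product\<close>

text \<open>
  The elements of \<open>L\<^sup>2\<close> are functions, so their inner product is only semidefinite: \<open>nrm (X - Y) = 0\<close>
  stands for equality almost everywhere. Vectors therefore live in a subspace \<open>H\<close> of an arbitrary real
  vector space, since the inner product is additive only where the integrals exist.
\<close>

locale semi_hilbert = vector_space scale
  for scale :: "real \<Rightarrow> 'v::ab_group_add \<Rightarrow> 'v" (infixr "\<cdot>" 75) +
  fixes H :: "'v set" and ip :: "'v \<Rightarrow> 'v \<Rightarrow> real"
  assumes subspace_H: "subspace H"
    and ip_add_left: "\<lbrakk>X \<in> H; Y \<in> H; Z \<in> H\<rbrakk> \<Longrightarrow> ip (X + Y) Z = ip X Z + ip Y Z"
    and ip_scale_left: "\<lbrakk>X \<in> H; Z \<in> H\<rbrakk> \<Longrightarrow> ip (c \<cdot> X) Z = c * ip X Z"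
    and ip_commute: "ip X Y = ip Y X"
    and ip_nonneg: "X \<in> H \<Longrightarrow> 0 \<le> ip X X"
    and ip_complete: "\<lbrakk>\<And>n. u n \<in> H; \<And>e. e > 0 \<Longrightarrow> \<exists>N. \<forall>m\<ge>N. \<forall>n\<ge>N. ip (u m - u n) (u m - u n) < e\<rbrakk>
        \<Longrightarrow> \<exists>X\<in>H. (\<lambda>n. ip (u n - X) (u n - X)) \<longlonglongrightarrow> 0"
begin

definition nrm :: "'v \<Rightarrow> real" where
  "nrm X = sqrt (ip X X)"

lemma H_closed [simp]:
  "0 \<in> H" "X \<in> H \<Longrightarrow> Y \<in> H \<Longrightarrow> X + Y \<in> H" "X \<in> H \<Longrightarrow> Y \<in> H \<Longrightarrow> X - Y \<in> H"
  "X \<in> H \<Longrightarrow> c \<cdot> X \<in> H" "X \<in> H \<Longrightarrow> - X \<in> H"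
  using subspace_H
  by (simp_all add: subspace_0 subspace_add subspace_diff subspace_scale subspace_neg)

lemma H_sum [simp]: "(\<And>k. k \<in> K \<Longrightarrow> V k \<in> H) \<Longrightarrow> sum V K \<in> H"
  by (rule subspace_sum[OF subspace_H])

lemma ip_add_right: "\<lbrakk>X \<in> H; Y \<in> H; Z \<in> H\<rbrakk> \<Longrightarrow> ip Z (X + Y) = ip Z X + ip Z Y"
  using ip_add_left ip_commute by metis

lemma ip_scale_right: "\<lbrakk>X \<in> H; Z \<in> H\<rbrakk> \<Longrightarrow> ip Z (c \<cdot> X) = c * ip Z X"
  using ip_scale_left ip_commute by metis

lemma ip_zero_left [simp]: "Z \<in> H \<Longrightarrow> ip 0 Z = 0"
  using ip_scale_left[of 0 Z 0] by simp

lemma ip_diff_left: "\<lbrakk>X \<in> H; Y \<in> H; Z \<in> H\<rbrakk> \<Longrightarrow> ip (X - Y) Z = ip X Z - ip Y Z"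
  using ip_add_left[of "X - Y" Y Z] by simp

lemma ip_diff_right: "\<lbrakk>X \<in> H; Y \<in> H; Z \<in> H\<rbrakk> \<Longrightarrow> ip Z (X - Y) = ip Z X - ip Z Y"
  using ip_diff_left ip_commute by metis

lemma ip_sum_left:
  assumes "\<And>k. k \<in> K \<Longrightarrow> V k \<in> H" "Z \<in> H"
  shows "ip (sum V K) Z = (\<Sum>k\<in>K. ip (V k) Z)"
  using assms
proof (induction K rule: infinite_finite_induct)
  case (insert k K)
  then show ?case by (simp add: ip_add_left)
qed simp_all

lemma nrm_nonneg [simp]: "X \<in> H \<Longrightarrow> 0 \<le> nrm X"
  by (simp add: nrm_def ip_nonneg)

lemma nrm_power2: "X \<in> H \<Longrightarrow> (nrm X)\<^sup>2 = ip X X"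
  by (simp add: nrm_def ip_nonneg)

lemma nrm_zero [simp]: "nrm 0 = 0"
  by (simp add: nrm_def)

lemma nrm_scale: "X \<in> H \<Longrightarrow> nrm (c \<cdot> X) = \<bar>c\<bar> * nrm X"
  by (simp add: nrm_def ip_scale_left ip_scale_right real_sqrt_mult flip: mult.assoc power2_eq_square)

lemma nrm_minus: "X \<in> H \<Longrightarrow> nrm (- X) = nrm X"
  using nrm_scale[of X "-1"] by (simp add: scale_minus_left)

lemma nrm_minus_commute: "\<lbrakk>X \<in> H; Y \<in> H\<rbrakk> \<Longrightarrow> nrm (X - Y) = nrm (Y - X)"
  using nrm_minus[of "X - Y"] by simp

lemma cauchy_schwarz:
  assumes X: "X \<in> H" and Y: "Y \<in> H"
  shows "\<bar>ip X Y\<bar> \<le> nrm X * nrm Y"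
proof -
  have pos: "0 \<le> ip X X + 2 * t * ip X Y + t\<^sup>2 * ip Y Y" for t
    using ip_nonneg[of "X + t \<cdot> Y"] X Y ip_commute[of Y X]
    by (simp add: ip_add_left ip_add_right ip_scale_left ip_scale_right algebra_simps power2_eq_square)
  have "(ip X Y)\<^sup>2 \<le> ip X X * ip Y Y"
  proof (cases "ip Y Y = 0")
    case True
    \<comment> \<open>An affine function of \<open>t\<close> that stays nonnegative is constant.\<close>
    have "ip X Y = 0"
    proof (rule ccontr)
      assume "ip X Y \<noteq> 0"
      then show False
        using pos[of "- (ip X X + 1) / (2 * ip X Y)"] True by (simp add: field_simps)
    qed
    then show ?thesis using True by simp
  next
    case False
    then have "ip Y Y > 0" using ip_nonneg[OF Y] by simp
    then show ?thesis
      using pos[of "- ip X Y / ip Y Y"] by (simp add: field_simps power2_eq_square)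
  qed
  then have "(ip X Y)\<^sup>2 \<le> (nrm X * nrm Y)\<^sup>2"
    by (simp add: power_mult_distrib nrm_power2 X Y)
  then show ?thesis
    using X Y by (metis abs_le_square_iff abs_of_nonneg mult_nonneg_nonneg nrm_nonneg)
qed

lemma nrm_triangle:
  assumes X: "X \<in> H" and Y: "Y \<in> H"
  shows "nrm (X + Y) \<le> nrm X + nrm Y"
proof (rule power2_le_imp_le)
  have "(nrm (X + Y))\<^sup>2 = (nrm X)\<^sup>2 + 2 * ip X Y + (nrm Y)\<^sup>2"
    using X Y by (simp add: nrm_power2 ip_add_left ip_add_right ip_commute[of Y X])
  also have "\<dots> \<le> (nrm X)\<^sup>2 + 2 * (nrm X * nrm Y) + (nrm Y)\<^sup>2"
    using cauchy_schwarz[OF X Y] by simp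
  finally show "(nrm (X + Y))\<^sup>2 \<le> (nrm X + nrm Y)\<^sup>2"
    by (simp add: power2_sum)
qed (use X Y in simp)

lemma nrm_triangle_diff:
  "\<lbrakk>X \<in> H; Y \<in> H; Z \<in> H\<rbrakk> \<Longrightarrow> nrm (X - Z) \<le> nrm (X - Y) + nrm (Y - Z)"
  using nrm_triangle[of "X - Y" "Y - Z"] by simp

lemma nrm_le_of_equal: "\<lbrakk>X \<in> H; Y \<in> H; nrm (X - Y) = 0\<rbrakk> \<Longrightarrow> nrm X \<le> nrm Y"
  using nrm_triangle_diff[of X Y 0] by simp

lemma nrm_cong:
  "\<lbrakk>X \<in> H; Y \<in> H; nrm (X - Y) = 0\<rbrakk> \<Longrightarrow> nrm X = nrm Y"
  by (metis nrm_le_of_equal nrm_minus_commute order_antisym)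

lemma ip_cong:
  assumes "X \<in> H" "Y \<in> H" "Z \<in> H" "nrm (X - Y) = 0"
  shows "ip X Z = ip Y Z"
  using cauchy_schwarz[of "X - Y" Z] assms by (simp add: ip_diff_left)

lemma nrm_tendsto_zeroI:
  assumes "\<And>n. u n \<in> H" "(\<lambda>n. ip (u n) (u n)) \<longlonglongrightarrow> 0"
  shows "(\<lambda>n. nrm (u n)) \<longlonglongrightarrow> 0"
  using tendsto_real_sqrt[OF assms(2)] by (simp add: nrm_def)

lemma nrm_complete:
  assumes u: "\<And>n. u n \<in> H"
    and cauchy: "\<And>e. e > 0 \<Longrightarrow> \<exists>N. \<forall>m\<ge>N. \<forall>n\<ge>N. nrm (u m - u n) < e"
  obtains X where "X \<in> H" "(\<lambda>n. nrm (u n - X)) \<longlonglongrightarrow> 0"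
proof -
  have "\<exists>N. \<forall>m\<ge>N. \<forall>n\<ge>N. ip (u m - u n) (u m - u n) < e" if "e > 0" for e
    using cauchy[of "sqrt e"] that by (simp add: nrm_def)
  from ip_complete[OF u this] obtain X where "X \<in> H" "(\<lambda>n. ip (u n - X) (u n - X)) \<longlonglongrightarrow> 0"
    by blast
  then show thesis using that nrm_tendsto_zeroI[of "\<lambda>n. u n - X"] u by simp
qed

text \<open>
  The Banach-Steinhaus theorem for seminorms, by Sokal's gliding hump, which uses completeness only
  through one Cauchy sequence. If the operator norms \<open>N i\<close> are unbounded, pick \<open>N (\<iota> n) > 4 ^ n\<close>
  and add vectors of size \<open>3 ^ (-n)\<close> at which \<open>p (\<iota> n)\<close> nearly attains its norm, each with the sign
  that makes \<open>p (\<iota> n)\<close> of the new sum at least \<open>p (\<iota> n)\<close> of the added vector. All later terms together have size at most \<open>3 ^ (-n) / 2\<close>, too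
  small to cancel the \<open>n\<close>-th one, so \<open>p (\<iota> n)\<close> at the limit is at least \<open>(4/3) ^ n / 4\<close>.
  Working with seminorms lets the lemma apply to maps that are linear only up to vectors of norm \<open>0\<close>.
\<close>

lemma uniform_boundedness:
  fixes p :: "'i \<Rightarrow> 'v \<Rightarrow> real"
  assumes p_add: "\<And>i X Y. \<lbrakk>i \<in> I; X \<in> H; Y \<in> H\<rbrakk> \<Longrightarrow> p i (X + Y) \<le> p i X + p i Y"
    and p_scale: "\<And>i X c. \<lbrakk>i \<in> I; X \<in> H\<rbrakk> \<Longrightarrow> p i (c \<cdot> X) = \<bar>c\<bar> * p i X"
    and p_bounded: "\<And>i. i \<in> I \<Longrightarrow> \<exists>K. \<forall>X\<in>H. p i X \<le> K * nrm X"
    and p_pointwise: "\<And>X. X \<in> H \<Longrightarrow> \<exists>B. \<forall>i\<in>I. p i X \<le> B"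
  shows "\<exists>M. \<forall>i\<in>I. \<forall>X\<in>H. p i X \<le> M * nrm X"
proof (rule ccontr)
  assume unbounded: "\<not> ?thesis"
  define ball where "ball = {X \<in> H. nrm X \<le> 1}"
  define N where "N i = (SUP X\<in>ball. p i X)" for i
  have ball_ne: "0 \<in> ball" by (simp add: ball_def)
  have bdd: "bdd_above (p i ` ball)" if i: "i \<in> I" for i
  proof -
    obtain K where K: "\<And>X. X \<in> H \<Longrightarrow> p i X \<le> K * nrm X" using p_bounded[OF i] by blast
    have "p i X \<le> \<bar>K\<bar>" if "X \<in> ball" for X
    proof -
      have "p i X \<le> K * nrm X" using K that by (simp add: ball_def)
      also have "\<dots> \<le> \<bar>K\<bar> * 1"
        using that by (intro mult_mono) (auto simp: ball_def)
      finally show ?thesis by simp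
    qed
    then show ?thesis by (auto simp: bdd_above_def)
  qed
  have p_le_N: "p i X \<le> N i * nrm X" if i: "i \<in> I" and X: "X \<in> H" for i X
  proof (cases "nrm X = 0")
    case True
    then show ?thesis using p_bounded[OF i] X by force
  next
    case False
    then have pos: "nrm X > 0" using X nrm_nonneg[of X] by linarith
    then have "(1 / nrm X) \<cdot> X \<in> ball" using X by (simp add: ball_def nrm_scale)
    then have "p i ((1 / nrm X) \<cdot> X) \<le> N i"
      unfolding N_def by (rule cSUP_upper[OF _ bdd[OF i]])
    then show ?thesis using pos X i by (simp add: p_scale field_simps)
  qed
  have "\<exists>i\<in>I. N i > 4 ^ n" for n :: nat
  proof (rule ccontr)
    assume "\<not> ?thesis"
    then have "p i X \<le> 4 ^ n * nrm X" if "i \<in> I" "X \<in> H" for i X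
      using p_le_N[OF that] that
      by (meson mult_right_mono not_le nrm_nonneg order_trans)
    then show False using unbounded by blast
  qed
  then obtain \<iota> where \<iota>: "\<And>n. \<iota> n \<in> I" "\<And>n. N (\<iota> n) > 4 ^ n" by metis
  have "\<exists>y\<in>ball. p (\<iota> n) y > 3/4 * N (\<iota> n)" for n
  proof -
    have "0 < N (\<iota> n)" using \<iota>(2)[of n] zero_less_power[of "4::real" n] by linarith
    then have "3/4 * N (\<iota> n) < (SUP X\<in>ball. p (\<iota> n) X)" by (simp flip: N_def)
    then show ?thesis
      using less_cSUP_iff[of ball "p (\<iota> n)" "3/4 * N (\<iota> n)"] ball_ne bdd[OF \<iota>(1), of n] by blast
  qed
  then obtain y where y: "\<And>n. y n \<in> ball" "\<And>n. p (\<iota> n) (y n) > 3/4 * N (\<iota> n)" by metis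
  define z where "z n = (1/3) ^ n \<cdot> y n" for n :: nat
  have zH: "z n \<in> H" and z_nrm: "nrm (z n) \<le> (1/3) ^ n"
    and pz: "p (\<iota> n) (z n) \<ge> (1/3) ^ n * (3/4 * N (\<iota> n))" for n
    using y[of n] \<iota>(1)[of n]
    by (simp_all add: z_def ball_def nrm_scale p_scale mult_left_le)
  \<comment> \<open>Either \<open>x + z\<close> or \<open>x - z\<close> has a seminorm at least that of \<open>z\<close>: their difference is \<open>2 z\<close>.\<close>
  define x where "x = rec_nat 0 (\<lambda>n a. if p (\<iota> n) (a + z n) \<ge> p (\<iota> n) (z n) then a + z n else a - z n)"
  have x_Suc: "x (Suc n) = (if p (\<iota> n) (x n + z n) \<ge> p (\<iota> n) (z n) then x n + z n else x n - z n)" for n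
    by (simp add: x_def)
  have xH: "x n \<in> H" for n
    by (induction n) (simp_all add: x_Suc zH, simp add: x_def)
  have p_neg: "p i (- X) = p i X" if "i \<in> I" "X \<in> H" for i X
    using p_scale[OF that, of "-1"] by simp
  have px: "p (\<iota> n) (x (Suc n)) \<ge> p (\<iota> n) (z n)" for n
  proof -
    have "2 * p (\<iota> n) (z n) = p (\<iota> n) (2 \<cdot> z n)"
      using \<iota>(1) zH by (simp add: p_scale)
    also have "2 \<cdot> z n = (x n + z n) + - (x n - z n)"
      using scale_left_distrib[of 1 1 "z n"] by simp
    also have "p (\<iota> n) \<dots> \<le> p (\<iota> n) (x n + z n) + p (\<iota> n) (x n - z n)"
      using p_add[of "\<iota> n" "x n + z n" "- (x n - z n)"] p_neg[of "\<iota> n" "x n - z n"] \<iota>(1) xH zH by simp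
    finally show ?thesis by (auto simp: x_Suc)
  qed
  have step: "nrm (x (Suc n) - x n) \<le> (1/3) ^ n" for n
    using z_nrm[of n] nrm_minus[OF zH[of n]] by (simp add: x_Suc)
  have tail: "nrm (x (n + k) - x n) \<le> 3/2 * ((1/3) ^ n - (1/3) ^ (n + k))" for n k
  proof (induction k)
    case (Suc k)
    have "nrm (x (n + Suc k) - x n) \<le> nrm (x (Suc (n + k)) - x (n + k)) + nrm (x (n + k) - x n)"
      using nrm_triangle_diff[of "x (Suc (n + k))" "x (n + k)" "x n"] xH by simp
    also have "\<dots> \<le> (1/3) ^ (n + k) + 3/2 * ((1/3) ^ n - (1/3) ^ (n + k))"
      by (intro add_mono step Suc)
    also have "\<dots> = 3/2 * ((1/3) ^ n - (1/3) ^ (n + Suc k))"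
      by (simp add: field_simps)
    finally show ?case .
  qed simp
  have tail': "nrm (x m - x n) \<le> 3/2 * (1/3) ^ n" if "n \<le> m" for m n
    using tail[of n "m - n"] that zero_le_power[of "1/3::real" m]
    by (simp add: algebra_simps del: power_divide zero_le_power)
  have geo: "(\<lambda>n. 3/2 * (1/3) ^ n :: real) \<longlonglongrightarrow> 0"
    by (intro tendsto_mult_right_zero LIMSEQ_realpow_zero) auto
  have "\<exists>N. \<forall>m\<ge>N. \<forall>n\<ge>N. nrm (x m - x n) < e" if "e > 0" for e
  proof -
    obtain N where N: "\<And>n. n \<ge> N \<Longrightarrow> 3/2 * (1/3) ^ n < e"
      using order_tendstoD(2)[OF geo \<open>e > 0\<close>] by (auto simp: eventually_sequentially)
    have "nrm (x m - x n) < e" if "m \<ge> N" "n \<ge> N" for m n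
    proof (cases "n \<le> m")
      case True
      then show ?thesis using tail'[of n m] N[of n] that by linarith
    next
      case False
      then show ?thesis
        using tail'[of m n] N[of m] that nrm_minus_commute[OF xH[of m] xH[of n]] by linarith
    qed
    then show ?thesis by blast
  qed
  then obtain X where X: "X \<in> H" "(\<lambda>n. nrm (x n - X)) \<longlonglongrightarrow> 0"
    using nrm_complete[of x] xH by blast
  have dist_X: "nrm (x n - X) \<le> 3/2 * (1/3) ^ n" for n
  proof (rule LIMSEQ_le_const)
    show "(\<lambda>m. 3/2 * (1/3) ^ n + nrm (x m - X)) \<longlonglongrightarrow> 3/2 * (1/3) ^ n"
      using tendsto_add[OF tendsto_const X(2)] by simp
    have "nrm (x n - X) \<le> 3/2 * (1/3) ^ n + nrm (x m - X)" if "n \<le> m" for m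
      using nrm_triangle_diff[of "x n" "x m" X] tail'[OF that] nrm_minus_commute[of "x n" "x m"]
        xH X(1) by simp
    then show "\<exists>M. \<forall>m\<ge>M. nrm (x n - X) \<le> 3/2 * (1/3) ^ n + nrm (x m - X)" by blast
  qed
  obtain B where B: "\<And>i. i \<in> I \<Longrightarrow> p i X \<le> B" using p_pointwise[OF X(1)] by blast
  have "(4/3) ^ n / 4 \<le> B" for n :: nat
  proof -
    let ?i = "\<iota> n"
    have Npos: "0 \<le> N ?i" using \<iota>(2)[of n] zero_less_power[of "4::real" n] by linarith
    have "(1/3) ^ n * (3/4 * N ?i) \<le> p ?i (x (Suc n))" using pz px order_trans by blast
    also have "\<dots> \<le> p ?i X + p ?i (x (Suc n) - X)"
      using p_add[of ?i X "x (Suc n) - X"] \<iota>(1) X(1) xH by simp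
    also have "p ?i (x (Suc n) - X) \<le> N ?i * nrm (x (Suc n) - X)"
      using p_le_N[OF \<iota>(1)] X(1) xH by simp
    also have "\<dots> \<le> N ?i * (3/2 * (1/3) ^ Suc n)"
      by (rule mult_left_mono[OF dist_X Npos])
    also have "p ?i X \<le> B" by (rule B[OF \<iota>(1)])
    finally have "(1/3) ^ n * N ?i / 4 \<le> B" by (simp add: algebra_simps)
    moreover have "(1/3) ^ n * 4 ^ n \<le> (1/3) ^ n * N ?i"
      using \<iota>(2)[of n] by (intro mult_left_mono) auto
    ultimately show ?thesis by (simp add: power_divide)
  qed
  moreover obtain n where "4 * B < (4/3) ^ n" using real_arch_pow[of "4/3" "4 * B"] by auto
  ultimately show False by (metis (no_types) less_divide_eq_numeral1(1) mult.commute not_le)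
qed


subsection \<open>Orthonormal systems\<close>

definition orthonormal :: "(nat \<Rightarrow> 'v) \<Rightarrow> bool" where
  "orthonormal \<phi> \<longleftrightarrow>
     (\<forall>k\<ge>1. \<phi> k \<in> H) \<and> (\<forall>j\<ge>1. \<forall>k\<ge>1. ip (\<phi> j) (\<phi> k) = (if j = k then 1 else 0))"

definition total :: "(nat \<Rightarrow> 'v) \<Rightarrow> bool" where
  "total \<phi> \<longleftrightarrow> (\<forall>X\<in>H. \<forall>\<epsilon>>0. \<exists>n c. nrm (X - (\<Sum>k=1..n. c k \<cdot> \<phi> k)) < \<epsilon>)"

definition converges_to :: "(nat \<Rightarrow> 'v) \<Rightarrow> 'v \<Rightarrow> bool" where
  "converges_to V X \<longleftrightarrow> (\<lambda>n. nrm ((\<Sum>k=1..n. V k) - X)) \<longlonglongrightarrow> 0"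

lemma ip_orthonormal_sum:
  assumes "orthonormal \<phi>" "finite K" "K \<subseteq> {1..}" "j \<ge> 1"
  shows "ip (\<Sum>k\<in>K. c k \<cdot> \<phi> k) (\<phi> j) = (if j \<in> K then c j else 0)"
proof -
  have "ip (\<Sum>k\<in>K. c k \<cdot> \<phi> k) (\<phi> j) = (\<Sum>k\<in>K. ip (c k \<cdot> \<phi> k) (\<phi> j))"
    using assms by (intro ip_sum_left) (auto simp: orthonormal_def)
  also have "\<dots> = (\<Sum>k\<in>K. if j = k then c j else 0)"
    using assms by (intro sum.cong) (auto simp: orthonormal_def ip_scale_left subset_iff)
  finally show ?thesis using assms by simp
qed

lemma orthonormal_sum_in_H:
  assumes "orthonormal \<phi>" "K \<subseteq> {1..}"
  shows "(\<Sum>k\<in>K. c k \<cdot> \<phi> k) \<in> H"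
  using assms by (intro H_sum) (auto simp: orthonormal_def)

lemma ip_orthonormal_sum_both:
  assumes on: "orthonormal \<phi>" and K: "finite K" "K \<subseteq> {1..}" and X: "X \<in> H"
  shows "ip X (\<Sum>k\<in>K. c k \<cdot> \<phi> k) = (\<Sum>k\<in>K. c k * ip X (\<phi> k))"
proof -
  have "ip (\<Sum>k\<in>K. c k \<cdot> \<phi> k) X = (\<Sum>k\<in>K. ip (c k \<cdot> \<phi> k) X)"
    using assms by (intro ip_sum_left) (auto simp: orthonormal_def)
  also have "\<dots> = (\<Sum>k\<in>K. c k * ip X (\<phi> k))"
    using assms by (intro sum.cong) (auto simp: orthonormal_def ip_scale_left subset_iff ip_commute[of X])
  finally show ?thesis by (simp add: ip_commute)
qed

lemma nrm_diff_orthonormal_sum: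
  assumes on: "orthonormal \<phi>" and K: "finite K" "K \<subseteq> {1..}" and X: "X \<in> H"
  shows "(nrm (X - (\<Sum>k\<in>K. c k \<cdot> \<phi> k)))\<^sup>2
    = (nrm X)\<^sup>2 - (\<Sum>k\<in>K. (ip X (\<phi> k))\<^sup>2) + (\<Sum>k\<in>K. (ip X (\<phi> k) - c k)\<^sup>2)"
proof -
  let ?P = "\<Sum>k\<in>K. c k \<cdot> \<phi> k"
  have P: "?P \<in> H" by (rule orthonormal_sum_in_H[OF on K(2)])
  have "ip ?P ?P = (\<Sum>k\<in>K. c k * ip ?P (\<phi> k))" by (rule ip_orthonormal_sum_both[OF on K P])
  also have "\<dots> = (\<Sum>k\<in>K. (c k)\<^sup>2)"
    using K by (intro sum.cong) (auto simp: ip_orthonormal_sum[OF on K] power2_eq_square)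
  finally have "ip (X - ?P) (X - ?P) = ip X X - 2 * (\<Sum>k\<in>K. c k * ip X (\<phi> k)) + (\<Sum>k\<in>K. (c k)\<^sup>2)"
    using ip_commute[of ?P X]
    by (simp add: ip_diff_left ip_diff_right X P ip_orthonormal_sum_both[OF on K X])
  also have "\<dots> = ip X X - (\<Sum>k\<in>K. (ip X (\<phi> k))\<^sup>2) + (\<Sum>k\<in>K. (ip X (\<phi> k) - c k)\<^sup>2)"
    by (simp add: power2_diff sum.distrib sum_subtractf sum_distrib_left mult.commute mult.left_commute)
  finally show ?thesis using X P by (simp add: nrm_power2)
qed

lemma bessel:
  assumes "orthonormal \<phi>" "finite K" "K \<subseteq> {1..}" "X \<in> H"
  shows "(\<Sum>k\<in>K. (ip X (\<phi> k))\<^sup>2) \<le> (nrm X)\<^sup>2"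
  using nrm_diff_orthonormal_sum[OF assms, of "\<lambda>k. ip X (\<phi> k)"]
    zero_le_power2[of "nrm (X - (\<Sum>k\<in>K. ip X (\<phi> k) \<cdot> \<phi> k))"] by simp

lemma fourier_coeff_summable:
  assumes "orthonormal \<phi>" "X \<in> H"
  shows "(\<lambda>k. (ip X (\<phi> k))\<^sup>2) summable_on {1..}"
proof (rule nonneg_bdd_above_summable_on)
  show "bdd_above (sum (\<lambda>k. (ip X (\<phi> k))\<^sup>2) ` {F. F \<subseteq> {1..} \<and> finite F})"
    by (rule bdd_aboveI2[of _ _ "(nrm X)\<^sup>2"]) (use bessel[OF assms(1) _ _ assms(2)] in blast)
qed simp

text \<open>
  Among all combinations of the first \<open>m\<close> vectors the one with the Fourier coefficients is closest to
  \<open>X\<close>, and its distance decreases with \<open>m\<close>; so density of the span already gives convergence.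
\<close>

lemma fourier_expansion:
  assumes on: "orthonormal \<phi>" and tot: "total \<phi>" and X: "X \<in> H"
  shows "converges_to (\<lambda>k. ip X (\<phi> k) \<cdot> \<phi> k) X"
  unfolding converges_to_def
proof (rule LIMSEQ_I)
  fix e :: real assume e: "e > 0"
  \<comment> \<open>The coefficients \<open>c\<close> may change with \<open>e\<close>; the Fourier coefficients do at least as well.\<close>
  obtain n c where nc: "nrm (X - (\<Sum>k=1..n. c k \<cdot> \<phi> k)) < e"
    using tot X e unfolding total_def by blast
  let ?P = "\<lambda>m. \<Sum>k=1..m. ip X (\<phi> k) \<cdot> \<phi> k"
  have PH: "?P m \<in> H" for m by (rule orthonormal_sum_in_H[OF on]) auto
  have QH: "(\<Sum>k=1..n. c k \<cdot> \<phi> k) \<in> H" by (rule orthonormal_sum_in_H[OF on]) auto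
  have "nrm (?P m - X) < e" if m: "m \<ge> n" for m
  proof -
    have "(nrm (X - ?P m))\<^sup>2 = (nrm X)\<^sup>2 - (\<Sum>k=1..m. (ip X (\<phi> k))\<^sup>2)"
      using nrm_diff_orthonormal_sum[OF on _ _ X, of "{1..m}" "\<lambda>k. ip X (\<phi> k)"] by simp
    also have "\<dots> \<le> (nrm X)\<^sup>2 - (\<Sum>k=1..n. (ip X (\<phi> k))\<^sup>2)"
      using m by (intro diff_left_mono sum_mono2) auto
    also have "\<dots> \<le> (nrm (X - (\<Sum>k=1..n. c k \<cdot> \<phi> k)))\<^sup>2"
      using nrm_diff_orthonormal_sum[OF on _ _ X, of "{1..n}" c] by (simp add: sum_nonneg)
    finally have "nrm (X - ?P m) \<le> nrm (X - (\<Sum>k=1..n. c k \<cdot> \<phi> k))"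
      by (rule power2_le_imp_le) (use X QH in simp)
    then show ?thesis using nc nrm_minus_commute[OF PH X] by simp
  qed
  then show "\<exists>N. \<forall>m\<ge>N. norm (nrm (?P m - X) - 0) < e"
    using PH X by (intro exI[of _ n]) simp
qed

text \<open>
  By Pythagoras the partial sums of the vector series are as far apart as those of the series of
  squares, so completeness of \<open>H\<close> provides the sum.
\<close>

lemma riesz_fischer:
  assumes on: "orthonormal \<phi>" and c: "(\<lambda>k. (c k)\<^sup>2) summable_on {1..}"
  obtains X where "X \<in> H" "converges_to (\<lambda>k. c k \<cdot> \<phi> k) X"
proof -
  let ?P = "\<lambda>m. \<Sum>k=1..m. c k \<cdot> \<phi> k" and ?s = "\<lambda>m. \<Sum>k=1..m. (c k)\<^sup>2"
  have PH: "?P m \<in> H" for m by (rule orthonormal_sum_in_H[OF on]) auto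
  have "filterlim (\<lambda>m::nat. {1..m}) (finite_subsets_at_top {1..}) sequentially"
    unfolding filterlim_finite_subsets_at_top
  proof (intro allI impI, elim conjE)
    fix K :: "nat set" assume K: "finite K" "K \<subseteq> {1..}"
    show "\<forall>\<^sub>F m in sequentially. finite {1..m} \<and> K \<subseteq> {1..m} \<and> {1..m} \<subseteq> {1..}"
      using eventually_ge_at_top[of "Max K"]
    proof eventually_elim
      case (elim m)
      then have "k \<le> m" if "k \<in> K" for k using Max_ge[OF K(1) that] by simp
      then show ?case using K(2) by auto
    qed
  qed
  moreover have "(sum (\<lambda>k. (c k)\<^sup>2) \<longlongrightarrow> (\<Sum>\<^sub>\<infinity>k\<in>{1..}. (c k)\<^sup>2)) (finite_subsets_at_top {1..})"
    using has_sum_infsum[OF c] by (simp add: has_sum_def)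
  ultimately have "Cauchy ?s"
    by (intro LIMSEQ_imp_Cauchy) (rule filterlim_compose)
  have pyth: "(nrm (?P m - ?P n))\<^sup>2 = \<bar>?s m - ?s n\<bar>" for m n
  proof -
    have *: "(nrm (?P m - ?P n))\<^sup>2 = ?s m - ?s n" if "n \<le> m" for m n
    proof -
      have "?P m - ?P n = (\<Sum>k\<in>{1..m} - {1..n}. c k \<cdot> \<phi> k)"
        using that by (subst sum_diff) auto
      moreover have "(nrm (0 - (\<Sum>k\<in>{1..m} - {1..n}. c k \<cdot> \<phi> k)))\<^sup>2 = (\<Sum>k\<in>{1..m} - {1..n}. (c k)\<^sup>2)"
      proof -
        have "ip 0 (\<phi> k) = 0" if "k \<in> {1..m} - {1..n}" for k
          using on that by (simp add: orthonormal_def)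
        then show ?thesis
          by (subst nrm_diff_orthonormal_sum[OF on]) auto
      qed
      moreover have "?s m - ?s n = (\<Sum>k\<in>{1..m} - {1..n}. (c k)\<^sup>2)"
        using that by (subst sum_diff) auto
      moreover have "(\<Sum>k\<in>{1..m} - {1..n}. c k \<cdot> \<phi> k) \<in> H"
        by (rule orthonormal_sum_in_H[OF on]) auto
      ultimately show ?thesis by (simp only: nrm_minus diff_0)
    qed
    have "?s n \<le> ?s m" if "n \<le> m" for m n
      using that by (intro sum_mono2) auto
    then show ?thesis
      using *[of n m] *[of m n] nrm_minus_commute[OF PH[of m] PH[of n]]
      by (cases "n \<le> m") (auto simp: abs_of_nonneg abs_of_nonpos)
  qed
  have "\<exists>N. \<forall>m\<ge>N. \<forall>n\<ge>N. nrm (?P m - ?P n) < e" if "e > 0" for e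
  proof -
    obtain N where N: "\<forall>m\<ge>N. \<forall>n\<ge>N. norm (?s m - ?s n) < e\<^sup>2"
      using CauchyD[OF \<open>Cauchy ?s\<close>, of "e\<^sup>2"] \<open>e > 0\<close> by auto
    have "nrm (?P m - ?P n) < e" if "m \<ge> N" "n \<ge> N" for m n
      using N that pyth[of m n] \<open>e > 0\<close> by (intro power_less_imp_less_base[of _ 2 e]) auto
    then show ?thesis by blast
  qed
  from nrm_complete[of ?P, OF PH this] show thesis
    using that unfolding converges_to_def by blast
qed

lemma ip_tendsto:
  assumes "\<And>n. u n \<in> H" "X \<in> H" "Z \<in> H" "(\<lambda>n. nrm (u n - X)) \<longlonglongrightarrow> 0"
  shows "(\<lambda>n. ip (u n) Z) \<longlonglongrightarrow> ip X Z"
proof (rule Lim_transform_bound[of "\<lambda>n. ip (u n) Z - ip X Z", THEN LIM_zero_cancel])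
  show "\<forall>\<^sub>F n in sequentially. norm (ip (u n) Z - ip X Z) \<le> norm (nrm (u n - X) * nrm Z)"
    using assms cauchy_schwarz[of "_ - X" Z] by (intro always_eventually) (simp add: ip_diff_left[symmetric])
  show "(\<lambda>n. nrm (u n - X) * nrm Z) \<longlonglongrightarrow> 0"
    by (rule tendsto_mult_left_zero[OF assms(4)])
qed

lemma coeff_of_expansion:
  assumes on: "orthonormal \<phi>" and X: "X \<in> H" and conv: "converges_to (\<lambda>k. c k \<cdot> \<phi> k) X"
    and j: "j \<ge> 1"
  shows "ip X (\<phi> j) = c j"
proof -
  have "(\<lambda>n. ip (\<Sum>k=1..n. c k \<cdot> \<phi> k) (\<phi> j)) \<longlonglongrightarrow> ip X (\<phi> j)"
    using on j conv X
    by (intro ip_tendsto orthonormal_sum_in_H) (auto simp: converges_to_def orthonormal_def)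
  moreover have "\<forall>\<^sub>F n in sequentially. ip (\<Sum>k=1..n. c k \<cdot> \<phi> k) (\<phi> j) = c j"
    using eventually_ge_at_top[of j]
    by eventually_elim (use j in \<open>simp add: ip_orthonormal_sum[OF on]\<close>)
  then have "(\<lambda>n. ip (\<Sum>k=1..n. c k \<cdot> \<phi> k) (\<phi> j)) \<longlonglongrightarrow> c j"
    by (rule tendsto_eventually)
  ultimately show ?thesis by (rule LIMSEQ_unique)
qed

lemma eq_of_coeffs:
  assumes on: "orthonormal \<phi>" and tot: "total \<phi>" and XY: "X \<in> H" "Y \<in> H"
    and coeffs: "\<And>k. k \<ge> 1 \<Longrightarrow> ip X (\<phi> k) = ip Y (\<phi> k)"
  shows "nrm (X - Y) = 0"
proof -
  have "ip (X - Y) (\<phi> k) = 0" if "k \<ge> 1" for k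
    using that on XY coeffs by (simp add: ip_diff_left orthonormal_def)
  then have "(\<Sum>k=1..n. ip (X - Y) (\<phi> k) \<cdot> \<phi> k) = 0" for n by simp
  then have "(\<lambda>n::nat. nrm (0 - (X - Y))) \<longlonglongrightarrow> 0"
    using fourier_expansion[OF on tot, of "X - Y"] XY by (simp add: converges_to_def)
  then have "nrm (0 - (X - Y)) = 0" using LIMSEQ_const_iff by blast
  then show ?thesis using nrm_minus[of "X - Y"] XY by simp
qed

end


section \<open>Eigenvectors of the generator of a semigroup\<close>

text \<open>
  The laws hold up to vectors of norm \<open>0\<close>, because on \<open>L\<^sup>2\<close> the operators act on representatives
  of classes of functions.
\<close>

locale hilbert_c0_semigroup = semi_hilbert scale H ip
  for scale :: "real \<Rightarrow> 'v::ab_group_add \<Rightarrow> 'v" (infixr "\<cdot>" 75) and H ip +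
  fixes S :: "real \<Rightarrow> 'v \<Rightarrow> 'v"
  assumes S_in_H: "\<lbrakk>t \<ge> 0; X \<in> H\<rbrakk> \<Longrightarrow> S t X \<in> H"
    and S_linear: "\<lbrakk>t \<ge> 0; X \<in> H; Y \<in> H\<rbrakk> \<Longrightarrow> nrm (S t (a \<cdot> X + b \<cdot> Y) - (a \<cdot> S t X + b \<cdot> S t Y)) = 0"
    and S_bounded: "t \<ge> 0 \<Longrightarrow> \<exists>M. \<forall>X\<in>H. nrm (S t X) \<le> M * nrm X"
    and S_zero: "X \<in> H \<Longrightarrow> nrm (S 0 X - X) = 0"
    and S_add: "\<lbrakk>s \<ge> 0; t \<ge> 0; X \<in> H\<rbrakk> \<Longrightarrow> nrm (S (s + t) X - S s (S t X)) = 0"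
    and S_continuous: "X \<in> H \<Longrightarrow> ((\<lambda>t. nrm (S t X - X)) \<longlongrightarrow> 0) (at_right 0)"
begin

lemma nrm_S_linear:
  assumes "t \<ge> 0" "X \<in> H" "Y \<in> H"
  shows "nrm (S t (a \<cdot> X + b \<cdot> Y)) = nrm (a \<cdot> S t X + b \<cdot> S t Y)"
  using assms by (intro nrm_cong S_linear) (simp_all add: S_in_H)

lemma nrm_S_scale:
  assumes "t \<ge> 0" "X \<in> H"
  shows "nrm (S t (a \<cdot> X)) = \<bar>a\<bar> * nrm (S t X)"
  using nrm_S_linear[OF assms assms(2), of a 0] assms by (simp add: nrm_scale S_in_H)

lemma nrm_S_add:
  assumes "t \<ge> 0" "X \<in> H" "Y \<in> H"
  shows "nrm (S t (X + Y)) \<le> nrm (S t X) + nrm (S t Y)"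
  using nrm_S_linear[OF assms, of 1 1] nrm_triangle[of "S t X" "S t Y"] assms by (simp add: S_in_H)

lemma S_diff:
  assumes "t \<ge> 0" "X \<in> H" "Y \<in> H"
  shows "nrm (S t X - S t Y) = nrm (S t (X - Y))"
  using nrm_S_linear[OF assms, of 1 "-1"] by (simp add: scale_minus_left)

text \<open>
  Strong continuity at \<open>0\<close> bounds each single orbit near \<open>0\<close>. If the operator norms were unbounded
  along some \<open>t n\<close> tending to \<open>0\<close>, the sequence \<open>S (t n)\<close> would contradict the uniform
  boundedness principle.
\<close>

lemma locally_bounded:
  obtains \<delta> M where "\<delta> > 0" "\<And>t X. \<lbrakk>0 < t; t \<le> \<delta>; X \<in> H\<rbrakk> \<Longrightarrow> nrm (S t X) \<le> M * nrm X"
proof -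
  have "\<exists>n::nat. \<forall>t X. 0 < t \<and> t \<le> 1 / Suc n \<and> X \<in> H \<longrightarrow> nrm (S t X) \<le> real n * nrm X"
  proof (rule ccontr)
    assume "\<not> ?thesis"
    then have "\<forall>n. \<exists>t X. 0 < t \<and> t \<le> 1 / Suc n \<and> X \<in> H \<and> \<not> nrm (S t X) \<le> real n * nrm X" by blast
    then obtain t X where t: "\<And>n. 0 < t n" "\<And>n. t n \<le> 1 / Suc n"
      and X: "\<And>n. X n \<in> H" "\<And>n. \<not> nrm (S (t n) (X n)) \<le> real n * nrm (X n)" by metis
    have t0: "0 \<le> t n" for n using t(1)[of n] by simp
    have "t \<longlonglongrightarrow> 0"
    proof (rule tendsto_sandwich[OF _ _ tendsto_const LIMSEQ_inverse_real_of_nat])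
      show "\<forall>\<^sub>F n in sequentially. t n \<le> inverse (real (Suc n))" "\<forall>\<^sub>F n in sequentially. 0 \<le> t n"
        using t(2) t0 by (simp_all add: divide_inverse)
    qed
    then have lim: "filterlim t (at_right 0) sequentially"
      using t(1) by (simp add: filterlim_at less_imp_neq[symmetric])
    have "\<exists>M. \<forall>n\<in>UNIV. \<forall>X\<in>H. nrm (S (t n) X) \<le> M * nrm X"
    proof (rule uniform_boundedness[where p = "\<lambda>n X. nrm (S (t n) X)" and I = UNIV])
      fix Y assume Y: "Y \<in> H"
      have "(\<lambda>n. nrm (S (t n) Y - Y)) \<longlonglongrightarrow> 0"
        using filterlim_compose[OF S_continuous[OF Y] lim] .
      then obtain B where B: "\<And>n. norm (nrm (S (t n) Y - Y)) \<le> B"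
        using convergent_imp_Bseq[OF convergentI] by (metis BseqE)
      have "nrm (S (t n) Y) \<le> B + nrm Y" for n
        using nrm_triangle[of "S (t n) Y - Y" Y] B[of n] Y t0 by (simp add: S_in_H)
      then show "\<exists>B. \<forall>n\<in>UNIV. nrm (S (t n) Y) \<le> B" by blast
    qed (use t0 in \<open>auto simp: nrm_S_add nrm_S_scale S_bounded\<close>)
    then obtain M where M: "\<And>n X. X \<in> H \<Longrightarrow> nrm (S (t n) X) \<le> M * nrm X" by blast
    obtain n :: nat where n: "M \<le> real n" using real_arch_simple by blast
    have "M * nrm (X n) \<le> real n * nrm (X n)" using n X(1)[of n] by (intro mult_right_mono) auto
    then show False using M[OF X(1), of n n] X(2)[of n] by linarith
  qed
  then obtain n :: nat where
    "\<And>t X. \<lbrakk>0 < t; t \<le> 1 / Suc n; X \<in> H\<rbrakk> \<Longrightarrow> nrm (S t X) \<le> real n * nrm X" by blast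
  then show thesis using that[of "1 / Suc n" "real n"] by simp
qed

text \<open>
  The generator applied to \<open>\<phi>\<close> is \<open>\<mu> \<cdot> \<phi>\<close>.
\<close>

definition eigenvector :: "real \<Rightarrow> 'v \<Rightarrow> bool" where
  "eigenvector \<mu> \<phi> \<longleftrightarrow> \<phi> \<in> H \<and>
     ((\<lambda>h. nrm ((1 / h) \<cdot> (S h \<phi> - \<phi>) - \<mu> \<cdot> \<phi>)) \<longlongrightarrow> 0) (at_right 0)"

text \<open>
  The orbit of \<open>\<phi>\<close> and \<open>exp (\<mu> * h) \<cdot> \<phi>\<close> have the same right derivative at \<open>0\<close>.
\<close>

lemma eigenvector_defect:
  assumes "eigenvector \<mu> \<phi>"
  shows "((\<lambda>h. nrm (S h \<phi> - exp (\<mu> * h) \<cdot> \<phi>) / h) \<longlongrightarrow> 0) (at_right 0)"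
proof -
  have \<phi>: "\<phi> \<in> H" using assms by (simp add: eigenvector_def)
  have "((\<lambda>h. exp (\<mu> * h)) has_real_derivative \<mu>) (at 0)"
    by (auto intro!: derivative_eq_intros)
  then have "((\<lambda>h. (exp (\<mu> * h) - 1) / h - \<mu>) \<longlongrightarrow> 0) (at_right 0)"
    using LIM_zero tendsto_within_subset[OF _ subset_UNIV] by (fastforce simp: DERIV_def)
  then have "((\<lambda>h. \<bar>(exp (\<mu> * h) - 1) / h - \<mu>\<bar> * nrm \<phi>) \<longlongrightarrow> 0) (at_right 0)"
    by (intro tendsto_mult_left_zero tendsto_rabs_zero)
  with assms have lim: "((\<lambda>h. nrm ((1 / h) \<cdot> (S h \<phi> - \<phi>) - \<mu> \<cdot> \<phi>)
      + \<bar>(exp (\<mu> * h) - 1) / h - \<mu>\<bar> * nrm \<phi>) \<longlongrightarrow> 0) (at_right 0)"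
    by (auto simp: eigenvector_def intro: tendsto_add_zero)
  show ?thesis
  proof (rule tendsto_sandwich[OF _ _ tendsto_const lim])
    have pos: "\<forall>\<^sub>F h in at_right 0. (0::real) < h" by (simp add: eventually_at_right_less)
    show "\<forall>\<^sub>F h in at_right 0. 0 \<le> nrm (S h \<phi> - exp (\<mu> * h) \<cdot> \<phi>) / h"
      using pos by eventually_elim (simp add: S_in_H \<phi>)
    show "\<forall>\<^sub>F h in at_right 0. nrm (S h \<phi> - exp (\<mu> * h) \<cdot> \<phi>) / h
        \<le> nrm ((1 / h) \<cdot> (S h \<phi> - \<phi>) - \<mu> \<cdot> \<phi>) + \<bar>(exp (\<mu> * h) - 1) / h - \<mu>\<bar> * nrm \<phi>"
      using pos
    proof eventually_elim
      case (elim h)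
      let ?c = "(exp (\<mu> * h) - 1) / h - \<mu>"
      have SH: "S h \<phi> \<in> H" using elim \<phi> by (simp add: S_in_H)
      have "nrm (S h \<phi> - exp (\<mu> * h) \<cdot> \<phi>) / h = nrm ((1 / h) \<cdot> (S h \<phi> - exp (\<mu> * h) \<cdot> \<phi>))"
        using elim SH \<phi> by (simp add: nrm_scale)
      also have "(1 / h) \<cdot> (S h \<phi> - exp (\<mu> * h) \<cdot> \<phi>)
          = ((1 / h) \<cdot> (S h \<phi> - \<phi>) - \<mu> \<cdot> \<phi>) - ?c \<cdot> \<phi>"
        using elim by (simp add: scale_right_diff_distrib scale_left_diff_distrib diff_divide_distrib)
      also have "nrm \<dots> \<le> nrm ((1 / h) \<cdot> (S h \<phi> - \<phi>) - \<mu> \<cdot> \<phi>) + nrm (?c \<cdot> \<phi>)"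
        using nrm_triangle[of "(1 / h) \<cdot> (S h \<phi> - \<phi>) - \<mu> \<cdot> \<phi>" "- (?c \<cdot> \<phi>)"] SH \<phi>
        by (simp add: nrm_minus)
      finally show ?case using \<phi> by (simp add: nrm_scale)
    qed
  qed
qed

text \<open>
  How the defect accumulates when a step of length \<open>t\<close> is followed by one of length \<open>s\<close>: write
  \<open>S s (S t \<phi>) - exp (\<mu> * (s + t)) \<cdot> \<phi>\<close> as \<open>S s\<close> of the defect at \<open>t\<close> plus \<open>exp (\<mu> * t)\<close>
  times the defect at \<open>s\<close>.
\<close>

lemma defect_step:
  assumes st: "s \<ge> 0" "t \<ge> 0" and \<phi>: "\<phi> \<in> H"
    and M: "\<And>X. X \<in> H \<Longrightarrow> nrm (S s X) \<le> M * nrm X"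
  shows "nrm (S (s + t) \<phi> - exp (\<mu> * (s + t)) \<cdot> \<phi>)
    \<le> M * nrm (S t \<phi> - exp (\<mu> * t) \<cdot> \<phi>) + exp (\<mu> * t) * nrm (S s \<phi> - exp (\<mu> * s) \<cdot> \<phi>)"
proof -
  note [simp] = S_in_H[OF st(1)] S_in_H[OF st(2)] \<phi> S_in_H[OF add_nonneg_nonneg[OF st]]
  let ?a = "exp (\<mu> * t)" and ?b = "exp (\<mu> * s)"
  have "nrm (S (s + t) \<phi> - exp (\<mu> * (s + t)) \<cdot> \<phi>) \<le>
      nrm (S (s + t) \<phi> - S s (S t \<phi>)) + nrm (S s (S t \<phi>) - exp (\<mu> * (s + t)) \<cdot> \<phi>)"
    by (rule nrm_triangle_diff) simp_all
  also have "\<dots> = nrm (S s (S t \<phi>) - exp (\<mu> * (s + t)) \<cdot> \<phi>)"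
    using S_add[OF st \<phi>] by simp
  also have "\<dots> \<le> nrm (S s (S t \<phi>) - S s (?a \<cdot> \<phi>)) + nrm (S s (?a \<cdot> \<phi>) - exp (\<mu> * (s + t)) \<cdot> \<phi>)"
    by (rule nrm_triangle_diff) simp_all
  also have "nrm (S s (S t \<phi>) - S s (?a \<cdot> \<phi>)) \<le> M * nrm (S t \<phi> - ?a \<cdot> \<phi>)"
    using M[of "S t \<phi> - ?a \<cdot> \<phi>"] st by (simp add: S_diff)
  also have "nrm (S s (?a \<cdot> \<phi>) - exp (\<mu> * (s + t)) \<cdot> \<phi>)
      \<le> nrm (S s (?a \<cdot> \<phi>) - ?a \<cdot> S s \<phi>) + nrm (?a \<cdot> S s \<phi> - exp (\<mu> * (s + t)) \<cdot> \<phi>)"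
    by (rule nrm_triangle_diff) simp_all
  also have "nrm (S s (?a \<cdot> \<phi>) - ?a \<cdot> S s \<phi>) = 0"
    using S_linear[OF st(1) \<phi> \<phi>, of ?a 0] by simp
  also have "?a \<cdot> S s \<phi> - exp (\<mu> * (s + t)) \<cdot> \<phi> = ?a \<cdot> (S s \<phi> - ?b \<cdot> \<phi>)"
    by (simp add: scale_right_diff_distrib distrib_left exp_add mult.commute)
  also have "nrm \<dots> = ?a * nrm (S s \<phi> - ?b \<cdot> \<phi>)"
    by (simp add: nrm_scale)
  finally show ?thesis by simp
qed

text \<open>
  The semigroup laws directly give only right continuity of orbits, so that a vanishing right derivative of
  \<open>exp (- \<mu> * t) \<cdot> S t \<phi>\<close> does not yet make it constant. Instead \<open>[0, t]\<close> is cut into \<open>n\<close> steps: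
  each one contributes a defect \<open>o(t / n)\<close>, magnified by at most a constant thanks to the uniform
  bound near \<open>0\<close>, and the sum of the \<open>n\<close> contributions tends to \<open>0\<close>.
\<close>

lemma eigenvector_orbit_small:
  assumes eig: "eigenvector \<mu> \<phi>" and t: "0 < t" "t \<le> \<delta>"
    and M: "\<And>t X. \<lbrakk>0 < t; t \<le> \<delta>; X \<in> H\<rbrakk> \<Longrightarrow> nrm (S t X) \<le> M * nrm X"
  shows "nrm (S t \<phi> - exp (\<mu> * t) \<cdot> \<phi>) = 0"
proof -
  have \<phi>: "\<phi> \<in> H" using eig by (simp add: eigenvector_def)
  define D where "D s = nrm (S s \<phi> - exp (\<mu> * s) \<cdot> \<phi>)" for s
  have D0: "0 \<le> D s" if "s \<ge> 0" for s
    using that \<phi> by (simp add: D_def S_in_H)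
  \<comment> \<open>A bound of at least \<open>1\<close> also covers the first step, to which no operator is applied.\<close>
  define M' where "M' = max M 1"
  have M': "M' \<ge> 0" "M' \<ge> 1" by (simp_all add: M'_def)
  have M'_bound: "nrm (S s X) \<le> M' * nrm X" if "0 < s" "s \<le> \<delta>" "X \<in> H" for s X
    using M[OF that] mult_right_mono[of M M' "nrm X"] that(3) by (simp add: M'_def)
  have steps: "D (real (Suc j) * h) \<le> real (Suc j) * M' * exp (\<bar>\<mu>\<bar> * (real (Suc j) * h)) * D h"
    if h: "h > 0" "real (Suc j) * h \<le> \<delta>" for j h
    using h(2)
  proof (induction j)
    case 0
    have "1 * D h \<le> (M' * exp (\<bar>\<mu>\<bar> * h)) * D h"
      using M'(2) h D0[of h] mult_mono[of 1 M' 1 "exp (\<bar>\<mu>\<bar> * h)"] by (intro mult_right_mono) auto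
    then show ?case by simp
  next
    case (Suc j)
    let ?s = "real (Suc j) * h"
    let ?E = "exp (\<bar>\<mu>\<bar> * (?s + h))"
    have s: "?s > 0" "?s \<le> \<delta>" "real (Suc (Suc j)) * h = ?s + h"
      using Suc.prems h(1) by (auto simp: algebra_simps intro: add_pos_nonneg)
    have "D (?s + h) \<le> M' * D h + exp (\<mu> * h) * D ?s"
      unfolding D_def using s h(1) \<phi> by (intro defect_step M'_bound) auto
    also have "\<dots> \<le> M' * D h + exp (\<bar>\<mu>\<bar> * h) * (real (Suc j) * M' * exp (\<bar>\<mu>\<bar> * ?s) * D h)"
      using Suc.IH[OF s(2)] D0[of ?s] s(1) h(1)
      by (intro add_left_mono mult_mono) (auto intro!: mult_right_mono)
    also have "\<dots> = M' * D h * 1 + real (Suc j) * M' * ?E * D h"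
    proof -
      have "?E = exp (\<bar>\<mu>\<bar> * h) * exp (\<bar>\<mu>\<bar> * ?s)"
        by (simp only: distrib_left exp_add mult.commute)
      then show ?thesis by simp
    qed
    also have "\<dots> \<le> M' * D h * ?E + real (Suc j) * M' * ?E * D h"
      using M'(1) D0[of h] h(1) s(1) by (intro add_right_mono mult_left_mono) auto
    also have "\<dots> = real (Suc (Suc j)) * M' * ?E * D h"
      by (simp add: algebra_simps)
    finally show ?case unfolding s(3) .
  qed
  have bound: "D t \<le> t * M' * exp (\<bar>\<mu>\<bar> * t) * (D (t / Suc j) / (t / Suc j))" for j
    using steps[of "t / Suc j" j] t by (simp add: mult_ac)
  have "(\<lambda>j. t / real (Suc j)) \<longlonglongrightarrow> 0"
    using tendsto_mult_right_zero[OF LIMSEQ_inverse_real_of_nat] by (simp add: divide_inverse)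
  then have "filterlim (\<lambda>j. t / real (Suc j)) (at_right 0) sequentially"
    using t by (auto simp: filterlim_at intro!: always_eventually)
  from filterlim_compose[OF eigenvector_defect[OF eig] this]
  have "(\<lambda>j. D (t / Suc j) / (t / Suc j)) \<longlonglongrightarrow> 0"
    unfolding D_def .
  then have "(\<lambda>j. t * M' * exp (\<bar>\<mu>\<bar> * t) * (D (t / Suc j) / (t / Suc j))) \<longlonglongrightarrow> 0"
    by (rule tendsto_mult_right_zero)
  then have "D t \<le> 0"
    using bound by (intro LIMSEQ_le_const[of _ 0 "D t"]) auto
  then show ?thesis using D0[of t] t by (simp add: D_def)
qed

text \<open>
  The semigroup law carries the identity from one interval of length \<open>\<delta>\<close> to the next.
\<close>

lemma eigenvector_orbit:
  assumes eig: "eigenvector \<mu> \<phi>" and t: "t \<ge> 0"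
  shows "nrm (S t \<phi> - exp (\<mu> * t) \<cdot> \<phi>) = 0"
proof -
  have \<phi>: "\<phi> \<in> H" using eig by (simp add: eigenvector_def)
  obtain \<delta> M where \<delta>: "\<delta> > 0"
    and M: "\<And>t X. \<lbrakk>0 < t; t \<le> \<delta>; X \<in> H\<rbrakk> \<Longrightarrow> nrm (S t X) \<le> M * nrm X"
    using locally_bounded by blast
  have "nrm (S t \<phi> - exp (\<mu> * t) \<cdot> \<phi>) = 0" if "0 \<le> t" "t \<le> real n * \<delta>" for t n
    using that
  proof (induction n arbitrary: t)
    case 0
    then show ?case using S_zero[OF \<phi>] by simp
  next
    case (Suc n)
    show ?case
    proof (cases "t \<le> real n * \<delta>")
      case True
      then show ?thesis using Suc by simp
    next
      case False
      then have n\<delta>: "0 \<le> real n * \<delta>" "0 < t - real n * \<delta>" "t - real n * \<delta> \<le> \<delta>"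
        using Suc.prems \<delta> by (auto simp: algebra_simps)
      obtain K where K: "\<And>X. X \<in> H \<Longrightarrow> nrm (S (real n * \<delta>) X) \<le> K * nrm X"
        using S_bounded[OF n\<delta>(1)] by blast
      have "nrm (S t \<phi> - exp (\<mu> * t) \<cdot> \<phi>) \<le> 0"
        using defect_step[OF n\<delta>(1) less_imp_le[OF n\<delta>(2)] \<phi> K, of \<mu>]
          eigenvector_orbit_small[OF eig n\<delta>(2,3) M] Suc.IH[OF n\<delta>(1)] by simp
      then show ?thesis
        using nrm_nonneg[of "S t \<phi> - exp (\<mu> * t) \<cdot> \<phi>"] \<phi> Suc.prems(1)
        by (simp add: S_in_H order_antisym)
    qed
  qed
  moreover obtain n :: nat where "t \<le> real n * \<delta>"
    using reals_Archimedean3[OF \<delta>, rule_format, of t] by (auto intro: less_imp_le)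
  ultimately show ?thesis using t by blast
qed

lemma S_sum:
  assumes t: "t \<ge> 0" and V: "\<And>k. k \<in> K \<Longrightarrow> V k \<in> H \<and> nrm (S t (V k) - e k \<cdot> V k) = 0"
    and fin: "finite K"
  shows "nrm (S t (\<Sum>k\<in>K. c k \<cdot> V k) - (\<Sum>k\<in>K. (c k * e k) \<cdot> V k)) = 0"
  using fin V
proof (induction K)
  case empty
  then show ?case using nrm_S_scale[OF t H_closed(1), of 0] by simp
next
  case (insert k K)
  let ?P = "\<Sum>k\<in>K. c k \<cdot> V k" and ?Q = "\<Sum>k\<in>K. (c k * e k) \<cdot> V k"
  have VH: "V j \<in> H" if "j \<in> insert k K" for j using insert.prems that by blast
  have PQ: "?P \<in> H" "?Q \<in> H" using VH by simp_all
  note [simp] = PQ VH[of k, simplified] S_in_H[OF t]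
  have "nrm (S t (c k \<cdot> V k + ?P) - (c k \<cdot> (e k \<cdot> V k) + ?Q))
      \<le> nrm (S t (c k \<cdot> V k + ?P) - (c k \<cdot> S t (V k) + S t ?P))
        + nrm ((c k \<cdot> S t (V k) + S t ?P) - (c k \<cdot> (e k \<cdot> V k) + ?Q))"
    by (rule nrm_triangle_diff) simp_all
  also have "nrm (S t (c k \<cdot> V k + ?P) - (c k \<cdot> S t (V k) + S t ?P)) = 0"
    using S_linear[OF t, of "V k" ?P "c k" 1] by simp
  also have "(c k \<cdot> S t (V k) + S t ?P) - (c k \<cdot> (e k \<cdot> V k) + ?Q)
      = c k \<cdot> (S t (V k) - e k \<cdot> V k) + (S t ?P - ?Q)"
    by (simp only: scale_right_diff_distrib) simp
  also have "nrm \<dots> \<le> nrm (c k \<cdot> (S t (V k) - e k \<cdot> V k)) + nrm (S t ?P - ?Q)"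
    by (rule nrm_triangle) simp_all
  also have "\<dots> = 0"
    using insert.prems[of k] insert.IH insert.prems by (simp add: nrm_scale)
  finally have "nrm (S t (c k \<cdot> V k + ?P) - (c k \<cdot> (e k \<cdot> V k) + ?Q)) \<le> 0"
    by simp
  then have "nrm (S t (c k \<cdot> V k + ?P) - (c k \<cdot> (e k \<cdot> V k) + ?Q)) = 0"
    using nrm_nonneg[of "S t (c k \<cdot> V k + ?P) - (c k \<cdot> (e k \<cdot> V k) + ?Q)"]
    by (intro order_antisym) simp_all
  then show ?case using insert.hyps by simp
qed

text \<open>
  The semigroup is diagonal in the basis \<open>\<phi>\<close>. On finite combinations this is linearity, and the general
  case follows because \<open>S t\<close> is continuous and the Fourier series converges.
\<close>

lemma S_coeff:
  assumes on: "orthonormal \<phi>" and tot: "total \<phi>"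
    and eig: "\<And>k. k \<ge> 1 \<Longrightarrow> eigenvector (\<mu> k) (\<phi> k)"
    and t: "t \<ge> 0" and X: "X \<in> H" and j: "j \<ge> 1"
  shows "ip (S t X) (\<phi> j) = exp (\<mu> j * t) * ip X (\<phi> j)"
proof -
  let ?P = "\<lambda>n. \<Sum>k=1..n. ip X (\<phi> k) \<cdot> \<phi> k"
  let ?Q = "\<lambda>n. \<Sum>k=1..n. (ip X (\<phi> k) * exp (\<mu> k * t)) \<cdot> \<phi> k"
  have PH: "?P n \<in> H" and QH: "?Q n \<in> H" for n by (rule orthonormal_sum_in_H[OF on]; force)+
  have \<phi>j: "\<phi> j \<in> H" using on j by (simp add: orthonormal_def)
  have conv: "(\<lambda>n. nrm (?P n - X)) \<longlonglongrightarrow> 0"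
    using fourier_expansion[OF on tot X] by (simp add: converges_to_def)
  obtain M where M: "\<And>X. X \<in> H \<Longrightarrow> nrm (S t X) \<le> M * nrm X"
    using S_bounded[OF t] by blast
  have "(\<lambda>n. nrm (S t (?P n) - S t X)) \<longlonglongrightarrow> 0"
  proof (rule tendsto_sandwich[OF _ _ tendsto_const tendsto_mult_right_zero[OF conv, of M]])
    show "\<forall>\<^sub>F n in sequentially. 0 \<le> nrm (S t (?P n) - S t X)"
      using PH X t by (simp add: S_in_H)
    show "\<forall>\<^sub>F n in sequentially. nrm (S t (?P n) - S t X) \<le> M * nrm (?P n - X)"
      using M PH X t by (simp add: S_diff)
  qed
  then have "(\<lambda>n. ip (S t (?P n)) (\<phi> j)) \<longlonglongrightarrow> ip (S t X) (\<phi> j)"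
    using PH X t \<phi>j by (intro ip_tendsto) (simp_all add: S_in_H)
  moreover have "(\<lambda>n. ip (S t (?P n)) (\<phi> j)) \<longlonglongrightarrow> exp (\<mu> j * t) * ip X (\<phi> j)"
    using eventually_ge_at_top[of j]
  proof (intro tendsto_eventually, eventually_elim)
    case (elim n)
    have "nrm (S t (?P n) - ?Q n) = 0"
      using on eig t by (intro S_sum) (auto simp: orthonormal_def eigenvector_orbit)
    then have "ip (S t (?P n)) (\<phi> j) = ip (?Q n) (\<phi> j)"
      using PH QH t \<phi>j by (intro ip_cong) (simp_all add: S_in_H)
    also have "\<dots> = exp (\<mu> j * t) * ip X (\<phi> j)"
      using elim j by (subst ip_orthonormal_sum[OF on]) auto
    finally show ?case .
  qed
  ultimately show ?thesis by (rule LIMSEQ_unique)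
qed

text \<open>
  \<open>S t G\<close> equals \<open>Y\<close> exactly when their coefficients agree, that is when the coefficients of \<open>G\<close> are
  \<open>exp (- \<mu> k * t) * ip Y (\<phi> k)\<close>. Bessel's inequality and the Riesz-Fischer theorem say which
  sequences are coefficients of some \<open>G\<close>.
\<close>

lemma backward_problem:
  assumes on: "orthonormal \<phi>" and tot: "total \<phi>"
    and eig: "\<And>k. k \<ge> 1 \<Longrightarrow> eigenvector (\<mu> k) (\<phi> k)"
    and t: "t \<ge> 0" and Y: "Y \<in> H"
  shows solution_iff: "G \<in> H \<Longrightarrow>
      nrm (S t G - Y) = 0 \<longleftrightarrow> converges_to (\<lambda>k. (exp (- \<mu> k * t) * ip Y (\<phi> k)) \<cdot> \<phi> k) G"
    and solvable_iff: "(\<exists>G\<in>H. nrm (S t G - Y) = 0) \<longleftrightarrow>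
      (\<lambda>k. exp (- 2 * \<mu> k * t) * (ip Y (\<phi> k))\<^sup>2) summable_on {1..}"
proof -
  define c where "c k = exp (- \<mu> k * t) * ip Y (\<phi> k)" for k
  have \<phi>H: "\<phi> k \<in> H" if "k \<ge> 1" for k using on that by (simp add: orthonormal_def)
  have inv: "exp (\<mu> k * t) * a = b \<longleftrightarrow> a = exp (- \<mu> k * t) * b" for a b k
    by (auto simp: exp_minus field_simps)
  have coeffs: "nrm (S t G - Y) = 0 \<longleftrightarrow> (\<forall>k\<ge>1. ip G (\<phi> k) = c k)" if G: "G \<in> H" for G
  proof -
    have "nrm (S t G - Y) = 0 \<longleftrightarrow> (\<forall>k\<ge>1. ip (S t G) (\<phi> k) = ip Y (\<phi> k))"
      using ip_cong[of "S t G" Y] eq_of_coeffs[OF on tot, of "S t G" Y] G Y t \<phi>H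
      by (auto simp: S_in_H)
    then show ?thesis using S_coeff[OF on tot eig t G] by (simp add: c_def inv)
  qed
  have conv: "nrm (S t G - Y) = 0 \<longleftrightarrow> converges_to (\<lambda>k. c k \<cdot> \<phi> k) G" if G: "G \<in> H" for G
  proof
    assume "nrm (S t G - Y) = 0"
    then have "ip G (\<phi> k) = c k" if "k \<ge> 1" for k using coeffs[OF G] that by blast
    then have "(\<Sum>k=1..n. c k \<cdot> \<phi> k) = (\<Sum>k=1..n. ip G (\<phi> k) \<cdot> \<phi> k)" for n
      by (intro sum.cong) auto
    then show "converges_to (\<lambda>k. c k \<cdot> \<phi> k) G"
      using fourier_expansion[OF on tot G] by (simp add: converges_to_def)
  next
    assume "converges_to (\<lambda>k. c k \<cdot> \<phi> k) G"
    then show "nrm (S t G - Y) = 0"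
      using coeffs[OF G] coeff_of_expansion[OF on G] by blast
  qed
  then show "nrm (S t G - Y) = 0 \<longleftrightarrow>
      converges_to (\<lambda>k. (exp (- \<mu> k * t) * ip Y (\<phi> k)) \<cdot> \<phi> k) G" if "G \<in> H"
    using that by (simp add: c_def)
  have sq: "exp (- 2 * \<mu> k * t) * (ip Y (\<phi> k))\<^sup>2 = (c k)\<^sup>2" for k
    by (simp add: c_def power_mult_distrib mult.assoc flip: exp_double)
  have "(\<exists>G\<in>H. nrm (S t G - Y) = 0) \<longleftrightarrow> (\<lambda>k. (c k)\<^sup>2) summable_on {1..}"
  proof
    assume "\<exists>G\<in>H. nrm (S t G - Y) = 0"
    then obtain G where G: "G \<in> H" "\<forall>k\<ge>1. ip G (\<phi> k) = c k" using coeffs by blast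
    have "(\<lambda>k. (ip G (\<phi> k))\<^sup>2) summable_on {1..} \<longleftrightarrow> (\<lambda>k. (c k)\<^sup>2) summable_on {1..}"
      by (rule summable_on_cong) (use G(2) in simp)
    then show "(\<lambda>k. (c k)\<^sup>2) summable_on {1..}"
      using fourier_coeff_summable[OF on G(1)] by blast
  next
    assume "(\<lambda>k. (c k)\<^sup>2) summable_on {1..}"
    then show "\<exists>G\<in>H. nrm (S t G - Y) = 0"
      using riesz_fischer[OF on] conv by metis
  qed
  then show "(\<exists>G\<in>H. nrm (S t G - Y) = 0) \<longleftrightarrow>
      (\<lambda>k. exp (- 2 * \<mu> k * t) * (ip Y (\<phi> k))\<^sup>2) summable_on {1..}"
    unfolding sq .
qed

end


section \<open>Completeness of \<open>L\<^sup>2\<close>\<close>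

lemma square_integrable_mult:
  assumes "f \<in> square_integrable M" "g \<in> square_integrable M"
  shows "integrable M (\<lambda>x. f x * g x)"
proof (rule Bochner_Integration.integrable_bound)
  show "integrable M (\<lambda>x. (f x)\<^sup>2 + (g x)\<^sup>2)" "(\<lambda>x. f x * g x) \<in> borel_measurable M"
    using assms by (auto simp: square_integrable_def)
  have "\<bar>a * b\<bar> \<le> a\<^sup>2 + b\<^sup>2" for a b :: real
    using sum_squares_bound[of "\<bar>a\<bar>" "\<bar>b\<bar>"] abs_ge_zero[of "a * b"]
    unfolding abs_mult power2_abs by linarith
  then show "AE x in M. norm (f x * g x) \<le> norm ((f x)\<^sup>2 + (g x)\<^sup>2)"
    by simp
qed

lemma square_integrable_add:
  assumes "f \<in> square_integrable M" "g \<in> square_integrable M"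
  shows "f + g \<in> square_integrable M"
proof -
  have "(\<lambda>x. (f x + g x)\<^sup>2) = (\<lambda>x. (f x)\<^sup>2 + (g x)\<^sup>2 + 2 * (f x * g x))"
    by (simp add: power2_sum fun_eq_iff)
  moreover have "integrable M (\<lambda>x. (f x)\<^sup>2 + (g x)\<^sup>2 + 2 * (f x * g x))"
    using assms square_integrable_mult[OF assms] by (auto simp: square_integrable_def)
  ultimately show ?thesis using assms by (auto simp: square_integrable_def plus_fun_def)
qed

lemma square_integrable_scale:
  "f \<in> square_integrable M \<Longrightarrow> (\<lambda>x. c * f x) \<in> square_integrable M"
  by (auto simp: square_integrable_def power_mult_distrib)

lemma square_integrable_diff:
  "f \<in> square_integrable M \<Longrightarrow> g \<in> square_integrable M \<Longrightarrow> (\<lambda>x. f x - g x) \<in> square_integrable M"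
  using square_integrable_add[OF _ square_integrable_scale[of g M "-1"], of f]
  by (simp add: plus_fun_def)

text \<open>
  A subsequence \<open>v\<close> whose increments are geometrically small in \<open>L\<^sup>2\<close> converges almost everywhere,
  and Fatou's lemma, applied to \<open>(u n - v k)\<^sup>2\<close> as \<open>k\<close> grows, identifies its pointwise limit as the
  \<open>L\<^sup>2\<close> limit of the whole sequence.
\<close>

lemma l2_complete:
  assumes u: "\<And>n. u n \<in> square_integrable M"
    and cauchy: "\<And>e. e > 0 \<Longrightarrow> \<exists>N. \<forall>m\<ge>N. \<forall>n\<ge>N. (LINT x|M. (u m x - u n x)\<^sup>2) < e"
  shows "\<exists>f. l2_tendsto M u f"
proof -
  have "\<forall>k::nat. \<exists>N. \<forall>m\<ge>N. \<forall>n\<ge>N. (LINT x|M. (u m x - u n x)\<^sup>2) < (1/8) ^ k"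
    using cauchy by simp
  then obtain N where N: "\<And>k m n. m \<ge> N k \<Longrightarrow> n \<ge> N k \<Longrightarrow> (LINT x|M. (u m x - u n x)\<^sup>2) < (1/8) ^ k"
    by metis
  \<comment> \<open>Summing the thresholds makes the subsequence increasing; the extra \<open>k\<close> makes it unbounded.\<close>
  define r where "r k = k + (\<Sum>j\<le>k. N j)" for k
  have r_ge: "r k \<ge> N k" "r k \<ge> k" and r_Suc: "r (Suc k) \<ge> r k" for k
    using member_le_sum[of k "{..k}" N] by (auto simp: r_def)
  define v where "v k = u (r k)" for k
  have meas [measurable]: "u n \<in> borel_measurable M" for n
    using u by (simp add: square_integrable_def)
  have v_meas [measurable]: "v n \<in> borel_measurable M" for n
    by (simp add: v_def)
  have int_diff: "integrable M (\<lambda>x. (u m x - u n x)\<^sup>2)" for m n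
    using square_integrable_diff[OF u u, of m n] by (simp add: square_integrable_def)
  have nn: "(\<integral>\<^sup>+x. ennreal ((u m x - u n x)\<^sup>2) \<partial>M) = ennreal (LINT x|M. (u m x - u n x)\<^sup>2)" for m n
    by (intro nn_integral_eq_integral int_diff) auto
  \<comment> \<open>The weights \<open>4 ^ k\<close> still leave a convergent series of integrals, and they force geometric
    decay of the increments pointwise.\<close>
  have "(\<integral>\<^sup>+x. (\<Sum>k. ennreal (4 ^ k * (v (Suc k) x - v k x)\<^sup>2)) \<partial>M)
      = (\<Sum>k. \<integral>\<^sup>+x. ennreal (4 ^ k * (v (Suc k) x - v k x)\<^sup>2) \<partial>M)"
    by (rule nn_integral_suminf) measurable
  also have "\<dots> \<le> (\<Sum>k. ennreal ((1/2) ^ k))"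
  proof (rule suminf_le)
    fix k
    have "(\<integral>\<^sup>+x. ennreal (4 ^ k * (v (Suc k) x - v k x)\<^sup>2) \<partial>M)
        = ennreal (4 ^ k) * (\<integral>\<^sup>+x. ennreal ((v (Suc k) x - v k x)\<^sup>2) \<partial>M)"
      by (subst nn_integral_cmult[symmetric]) (auto simp: ennreal_mult)
    also have "\<dots> = ennreal (4 ^ k * (LINT x|M. (v (Suc k) x - v k x)\<^sup>2))"
      by (simp add: v_def nn ennreal_mult)
    also have "\<dots> \<le> ennreal (4 ^ k * (1/8) ^ k)"
      using N[of k "r (Suc k)" "r k"] r_ge[of k] r_Suc[of k]
      by (intro ennreal_leI mult_left_mono) (auto simp: v_def)
    also have "(4::real) ^ k * (1/8) ^ k = (1/2) ^ k"
      by (simp flip: power_mult_distrib)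
    finally show "(\<integral>\<^sup>+x. ennreal (4 ^ k * (v (Suc k) x - v k x)\<^sup>2) \<partial>M) \<le> ennreal ((1/2) ^ k)" .
  qed auto
  also have "\<dots> = ennreal (\<Sum>k. (1/2) ^ k)"
    by (rule suminf_ennreal_eq) (auto intro!: summable_sums summable_geometric)
  finally have "(\<integral>\<^sup>+x. (\<Sum>k. ennreal (4 ^ k * (v (Suc k) x - v k x)\<^sup>2)) \<partial>M) \<noteq> \<infinity>"
    by (auto simp: top_unique)
  then have "AE x in M. (\<Sum>k. ennreal (4 ^ k * (v (Suc k) x - v k x)\<^sup>2)) \<noteq> \<infinity>"
    by (intro nn_integral_PInf_AE) auto
  then have conv: "AE x in M. (\<lambda>k. v k x) \<longlonglongrightarrow> lim (\<lambda>k. v k x)"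
  proof eventually_elim
    case (elim x)
    then have "summable (\<lambda>k. 4 ^ k * (v (Suc k) x - v k x)\<^sup>2)"
      by (intro summable_suminf_not_top) auto
    then have "(\<lambda>k. 4 ^ k * (v (Suc k) x - v k x)\<^sup>2) \<longlonglongrightarrow> 0" by (rule summable_LIMSEQ_zero)
    then have "eventually (\<lambda>k. 4 ^ k * (v (Suc k) x - v k x)\<^sup>2 < 1) sequentially"
      by (rule order_tendstoD) auto
    then have "eventually (\<lambda>k. norm (v (Suc k) x - v k x) \<le> (1/2) ^ k) sequentially"
    proof eventually_elim
      case (elim k)
      have "(2 ^ k * \<bar>v (Suc k) x - v k x\<bar>)\<^sup>2 = 4 ^ k * (v (Suc k) x - v k x)\<^sup>2"
        using power_mult_distrib[of "2::real" 2 k] by (simp add: power_mult_distrib power2_eq_square)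
      then have "(2 ^ k * \<bar>v (Suc k) x - v k x\<bar>)\<^sup>2 \<le> 1\<^sup>2" using elim by simp
      then have "2 ^ k * \<bar>v (Suc k) x - v k x\<bar> \<le> 1" by (rule power2_le_imp_le) simp
      then show ?case by (simp add: power_divide field_simps)
    qed
    then have "summable (\<lambda>k. v (Suc k) x - v k x)"
      by (rule summable_comparison_test_ev) (auto intro: summable_geometric)
    then have "convergent (\<lambda>n. v n x - v 0 x)"
      using sum_lessThan_telescope[of "\<lambda>k. v k x"]
      by (simp add: summable_iff_convergent)
    then have "convergent (\<lambda>n. (v n x - v 0 x) + v 0 x)"
      by (intro convergent_add convergent_const)
    then show ?case by (simp add: convergent_LIMSEQ_iff)
  qed
  define f where "f x = lim (\<lambda>k. v k x)" for x
  have f_meas [measurable]: "f \<in> borel_measurable M"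
    unfolding f_def by measurable
  have bound: "(\<integral>\<^sup>+x. ennreal ((u n x - f x)\<^sup>2) \<partial>M) \<le> ennreal e"
    if n: "\<forall>m\<ge>K. (LINT x|M. (u n x - u m x)\<^sup>2) < e" for n K e
  proof -
    have "(\<integral>\<^sup>+x. ennreal ((u n x - f x)\<^sup>2) \<partial>M)
        = (\<integral>\<^sup>+x. liminf (\<lambda>k. ennreal ((u n x - v k x)\<^sup>2)) \<partial>M)"
    proof (rule nn_integral_cong_AE)
      show "AE x in M. ennreal ((u n x - f x)\<^sup>2) = liminf (\<lambda>k. ennreal ((u n x - v k x)\<^sup>2))"
        using conv
      proof eventually_elim
        case (elim x)
        have "(\<lambda>k. ennreal ((u n x - v k x)\<^sup>2)) \<longlonglongrightarrow> ennreal ((u n x - f x)\<^sup>2)"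
          unfolding f_def by (intro tendsto_intros elim)
        from lim_imp_Liminf[OF _ this] show ?case by simp
      qed
    qed
    also have "\<dots> \<le> liminf (\<lambda>k. \<integral>\<^sup>+x. ennreal ((u n x - v k x)\<^sup>2) \<partial>M)"
      by (rule nn_integral_liminf) measurable
    also have "\<dots> \<le> ennreal e"
    proof (rule Liminf_le)
      show "\<forall>\<^sub>F k in sequentially. (\<integral>\<^sup>+x. ennreal ((u n x - v k x)\<^sup>2) \<partial>M) \<le> ennreal e"
        using eventually_ge_at_top[of K]
      proof eventually_elim
        case (elim k)
        then have "K \<le> r k" using r_ge(2)[of k] by linarith
        then have "(LINT x|M. (u n x - v k x)\<^sup>2) \<le> e" using n by (simp add: v_def less_imp_le)
        then show ?case by (simp add: v_def nn ennreal_leI)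
      qed
    qed simp
    finally show ?thesis .
  qed
  have int_f: "integrable M (\<lambda>x. (u n x - f x)\<^sup>2) \<and> (LINT x|M. (u n x - f x)\<^sup>2) \<le> e"
    if n: "\<forall>m\<ge>K. (LINT x|M. (u n x - u m x)\<^sup>2) < e" "e > 0" for n K e
  proof -
    have "integrable M (\<lambda>x. (u n x - f x)\<^sup>2)"
      using bound[OF n(1)] by (intro integrableI_bounded) (auto simp: le_less_trans)
    moreover from this have "ennreal (LINT x|M. (u n x - f x)\<^sup>2) \<le> ennreal e"
      using bound[OF n(1)] by (simp add: nn_integral_eq_integral)
    ultimately show ?thesis using n(2) by (simp add: ennreal_le_iff)
  qed
  have f_sq: "f \<in> square_integrable M"
  proof -
    have "\<forall>m\<ge>N 0. (LINT x|M. (u (N 0) x - u m x)\<^sup>2) < 1" using N[of 0] by simp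
    then have "(\<lambda>x. u (N 0) x - f x) \<in> square_integrable M"
      using int_f[of "N 0" "N 0" 1] by (simp add: square_integrable_def)
    from square_integrable_diff[OF u[of "N 0"] this] show ?thesis by simp
  qed
  have "(\<lambda>n. LINT x|M. (u n x - f x)\<^sup>2) \<longlonglongrightarrow> 0"
  proof (rule LIMSEQ_I)
    fix e :: real assume e: "e > 0"
    then obtain K where K: "\<forall>m\<ge>K. \<forall>n\<ge>K. (LINT x|M. (u m x - u n x)\<^sup>2) < e/2"
      using cauchy[of "e/2"] by auto
    have "(LINT x|M. (u n x - f x)\<^sup>2) \<le> e/2" if "n \<ge> K" for n
      using int_f[of K n "e/2"] K e that by simp
    then show "\<exists>K. \<forall>n\<ge>K. norm ((LINT x|M. (u n x - f x)\<^sup>2) - 0) < e"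
      using e by (intro exI[of _ K]) (force simp: abs_of_nonneg)
  qed
  then show ?thesis using u f_sq by (auto simp: l2_tendsto_def)
qed


section \<open>The space \<open>LL2\<close> and the backward problem\<close>

lemma LL2_smul: "X \<in> LL2 \<Omega> \<Longrightarrow> smul c X \<in> LL2 \<Omega>"
  by (auto simp: LL2_def smul_def square_integrable_scale)

lemma LL2_inner_complete:
  assumes u: "\<And>n. u n \<in> LL2 \<Omega>"
    and cauchy: "\<And>e. e > 0 \<Longrightarrow>
      \<exists>N. \<forall>m\<ge>N. \<forall>n\<ge>N. LL2_inner \<Omega> (u m - u n) (u m - u n) < e"
  shows "\<exists>X\<in>LL2 \<Omega>. (\<lambda>n. LL2_inner \<Omega> (u n - X) (u n - X)) \<longlonglongrightarrow> 0"
proof -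
  let ?M = "lebesgue_on \<Omega>" and ?N = "surface_measure \<Omega>"
  have split: "LL2_inner \<Omega> (X - Y) (X - Y)
      = (LINT x|?M. (fst X x - fst Y x)\<^sup>2) + (LINT x|?N. (snd X x - snd Y x)\<^sup>2)" for X Y
    by (simp add: LL2_inner_def power2_eq_square)
  have fst_le: "(LINT x|?M. (fst X x - fst Y x)\<^sup>2) \<le> LL2_inner \<Omega> (X - Y) (X - Y)"
    and snd_le: "(LINT x|?N. (snd X x - snd Y x)\<^sup>2) \<le> LL2_inner \<Omega> (X - Y) (X - Y)" for X Y
    by (simp_all add: split)
  have "\<exists>f. l2_tendsto ?M (\<lambda>n. fst (u n)) f"
  proof (rule l2_complete)
    fix e :: real assume "e > 0"
    from cauchy[OF this] show "\<exists>N. \<forall>m\<ge>N. \<forall>n\<ge>N. (LINT x|?M. (fst (u m) x - fst (u n) x)\<^sup>2) < e"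
      using le_less_trans[OF fst_le] by blast
  qed (use u in \<open>auto simp: LL2_def mem_Times_iff\<close>)
  moreover have "\<exists>g. l2_tendsto ?N (\<lambda>n. snd (u n)) g"
  proof (rule l2_complete)
    fix e :: real assume "e > 0"
    from cauchy[OF this] show "\<exists>N. \<forall>m\<ge>N. \<forall>n\<ge>N. (LINT x|?N. (snd (u m) x - snd (u n) x)\<^sup>2) < e"
      using le_less_trans[OF snd_le] by blast
  qed (use u in \<open>auto simp: LL2_def mem_Times_iff\<close>)
  ultimately obtain f g
    where fg: "l2_tendsto ?M (\<lambda>n. fst (u n)) f" "l2_tendsto ?N (\<lambda>n. snd (u n)) g" by blast
  then have "(f, g) \<in> LL2 \<Omega>" by (simp add: LL2_def l2_tendsto_def)
  moreover have "(\<lambda>n. LL2_inner \<Omega> (u n - (f, g)) (u n - (f, g))) \<longlonglongrightarrow> 0"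
    unfolding split using fg by (auto simp: l2_tendsto_def intro!: tendsto_add_zero)
  ultimately show ?thesis by blast
qed

lemma semi_hilbert_LL2: "semi_hilbert smul (LL2 \<Omega>) (LL2_inner \<Omega>)"
proof -
  interpret vector_space "smul :: real \<Rightarrow> 'a state \<Rightarrow> 'a state"
    by unfold_locales (auto simp: smul_def plus_prod_def plus_fun_def algebra_simps)
  show ?thesis
  proof unfold_locales
    show "subspace (LL2 \<Omega>)"
    proof (rule subspaceI)
      show "0 \<in> LL2 \<Omega>"
        by (simp add: LL2_def mem_Times_iff square_integrable_def zero_fun_def)
    qed (auto simp: LL2_smul, auto simp: LL2_def square_integrable_add)
  next
    fix X Y Z :: "'a state"
    assume "X \<in> LL2 \<Omega>" "Y \<in> LL2 \<Omega>" "Z \<in> LL2 \<Omega>"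
    then show "LL2_inner \<Omega> (X + Y) Z = LL2_inner \<Omega> X Z + LL2_inner \<Omega> Y Z"
      by (auto simp: LL2_inner_def LL2_def square_integrable_mult algebra_simps)
  next
    fix u :: "nat \<Rightarrow> 'a state"
    assume "\<And>n. u n \<in> LL2 \<Omega>"
      "\<And>e. e > 0 \<Longrightarrow> \<exists>N. \<forall>m\<ge>N. \<forall>n\<ge>N. LL2_inner \<Omega> (u m - u n) (u m - u n) < e"
    then show "\<exists>X\<in>LL2 \<Omega>. (\<lambda>n. LL2_inner \<Omega> (u n - X) (u n - X)) \<longlonglongrightarrow> 0"
      by (rule LL2_inner_complete)
  next
    show "LL2_inner \<Omega> (smul c X) Z = c * LL2_inner \<Omega> X Z" for c and X Z :: "'a state"
      by (simp add: LL2_inner_def smul_def mult.assoc distrib_left)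
    show "LL2_inner \<Omega> X Y = LL2_inner \<Omega> Y X" for X Y :: "'a state"
      by (simp add: LL2_inner_def mult.commute)
    show "0 \<le> LL2_inner \<Omega> X X" for X :: "'a state"
      by (simp add: LL2_inner_def)
  qed
qed

lemma LL2_norm_diff_eq_0_iff:
  assumes "X \<in> LL2 \<Omega>" "Y \<in> LL2 \<Omega>"
  shows "LL2_norm \<Omega> (X - Y) = 0 \<longleftrightarrow> LL2_eq \<Omega> X Y"
proof -
  let ?M = "lebesgue_on \<Omega>" and ?N = "surface_measure \<Omega>"
  have int: "integrable ?M (\<lambda>x. (fst X x - fst Y x)\<^sup>2)" "integrable ?N (\<lambda>x. (snd X x - snd Y x)\<^sup>2)"
    using assms square_integrable_diff[of "fst X" ?M "fst Y"] square_integrable_diff[of "snd X" ?N "snd Y"]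
    by (auto simp: LL2_def square_integrable_def)
  have "LL2_norm \<Omega> (X - Y) = 0 \<longleftrightarrow>
      (LINT x|?M. (fst X x - fst Y x)\<^sup>2) + (LINT x|?N. (snd X x - snd Y x)\<^sup>2) = 0"
    by (simp add: LL2_norm_def LL2_inner_def power2_eq_square)
  also have "\<dots> \<longleftrightarrow> (LINT x|?M. (fst X x - fst Y x)\<^sup>2) = 0 \<and> (LINT x|?N. (snd X x - snd Y x)\<^sup>2) = 0"
    by (rule add_nonneg_eq_0_iff) auto
  also have "\<dots> \<longleftrightarrow> LL2_eq \<Omega> X Y"
    using int by (simp add: integral_nonneg_eq_0_iff_AE LL2_eq_def)
  finally show ?thesis .
qed

theorem theorem4p2:
  fixes \<Omega> :: "'a::euclidean_space set"
    and T d \<gamma> :: real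
    and S :: "real \<Rightarrow> 'a state \<Rightarrow> 'a state"
    and lam :: "nat \<Rightarrow> real"
    and \<phi> :: "nat \<Rightarrow> 'a state"
    and Y_T :: "'a state"
  assumes "T > 0"
    and "C2_domain \<Omega>"
    and "d > 0"
    and "if DIM('a) \<ge> 2 then \<gamma> > 0 else \<gamma> = 0"
    and "generates \<Omega> (A0 \<Omega> d \<gamma>) S"
    and "eigensystem \<Omega> (neg_op (A0 \<Omega> d \<gamma>)) lam \<phi>"
    and "Y_T \<in> LL2 \<Omega>"
  shows "((\<exists>G\<in>LL2 \<Omega>. LL2_eq \<Omega> (final_state S T G) Y_T) \<longleftrightarrow>
            (\<lambda>k. exp (2 * lam k * T) * (LL2_inner \<Omega> Y_T (\<phi> k))\<^sup>2) summable_on {1..}) \<and>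
         ((\<lambda>k. exp (2 * lam k * T) * (LL2_inner \<Omega> Y_T (\<phi> k))\<^sup>2) summable_on {1..} \<longrightarrow>
            (\<forall>G\<in>LL2 \<Omega>. LL2_eq \<Omega> (final_state S T G) Y_T \<longleftrightarrow>
               LL2_sums \<Omega> (\<lambda>k. smul (exp (lam k * T) * LL2_inner \<Omega> Y_T (\<phi> k)) (\<phi> k)) G))"
proof -
  interpret L: semi_hilbert smul "LL2 \<Omega>" "LL2_inner \<Omega>"
    by (rule semi_hilbert_LL2)
  have nrm: "L.nrm = LL2_norm \<Omega>"
    by (simp add: fun_eq_iff L.nrm_def LL2_norm_def)
  have C0: "C0_semigroup \<Omega> S" and gen: "generator \<Omega> S = A0 \<Omega> d \<gamma>"
    using assms(5) by (simp_all add: generates_def)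
  have SH: "S t X \<in> LL2 \<Omega>" if "t \<ge> 0" "X \<in> LL2 \<Omega>" for t X
    using C0 that by (simp add: C0_semigroup_def)
  interpret P: hilbert_c0_semigroup smul "LL2 \<Omega>" "LL2_inner \<Omega>" S
  proof unfold_locales
    show "L.nrm (S t (smul a X + smul b Y) - (smul a (S t X) + smul b (S t Y))) = 0"
      if "t \<ge> 0" "X \<in> LL2 \<Omega>" "Y \<in> LL2 \<Omega>" for t X Y a b
      using C0 that by (simp add: nrm LL2_norm_diff_eq_0_iff SH C0_semigroup_def)
    show "L.nrm (S 0 X - X) = 0" if "X \<in> LL2 \<Omega>" for X
      using C0 that by (simp add: nrm LL2_norm_diff_eq_0_iff SH C0_semigroup_def)
    show "L.nrm (S (s + t) X - S s (S t X)) = 0" if "s \<ge> 0" "t \<ge> 0" "X \<in> LL2 \<Omega>" for s t X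
      using C0 that by (simp add: nrm LL2_norm_diff_eq_0_iff SH C0_semigroup_def)
  qed (use C0 in \<open>auto simp: nrm C0_semigroup_def\<close>)
  have on: "L.orthonormal \<phi>" and tot: "L.total \<phi>"
    using assms(6)
    by (simp_all add: eigensystem_def orthonormal_basis_def L.orthonormal_def L.total_def nrm)
  \<comment> \<open>The sign comes from \<open>neg_op\<close>: the \<open>lam k\<close> are eigenvalues of the negative of the generator.\<close>
  have eig: "P.eigenvector (- lam k) (\<phi> k)" if "k \<ge> 1" for k
  proof -
    have "A0 \<Omega> d \<gamma> (\<phi> k) (smul (-1) (smul (lam k) (\<phi> k)))"
      using assms(6) that by (simp add: eigensystem_def neg_op_def)
    then show ?thesis
      unfolding gen[symmetric] generator_def P.eigenvector_def nrm by simp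
  qed
  have sums: "L.converges_to V G \<longleftrightarrow> LL2_sums \<Omega> V G" for V G
    by (simp add: L.converges_to_def LL2_sums_def nrm)
  have eq: "L.nrm (S T G - Y_T) = 0 \<longleftrightarrow> LL2_eq \<Omega> (final_state S T G) Y_T" if "G \<in> LL2 \<Omega>" for G
    using that assms(1,7) by (simp add: nrm LL2_norm_diff_eq_0_iff SH final_state_def mild_solution_def)
  have T: "T \<ge> 0" using assms(1) by simp
  have "(\<exists>G\<in>LL2 \<Omega>. LL2_eq \<Omega> (final_state S T G) Y_T) \<longleftrightarrow>
      (\<lambda>k. exp (2 * lam k * T) * (LL2_inner \<Omega> Y_T (\<phi> k))\<^sup>2) summable_on {1..}"
    using P.solvable_iff[OF on tot eig T assms(7)] eq by simp
  moreover have "LL2_eq \<Omega> (final_state S T G) Y_T \<longleftrightarrow>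
      LL2_sums \<Omega> (\<lambda>k. smul (exp (lam k * T) * LL2_inner \<Omega> Y_T (\<phi> k)) (\<phi> k)) G" if "G \<in> LL2 \<Omega>" for G
    using P.solution_iff[OF on tot eig T assms(7) that] eq[OF that] by (simp add: sums)
  ultimately show ?thesis by blast
qed

end
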